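(* For every $A\in\mathcal{A}_n$, there exists a Robinson matrix $R\in\mathcal{A}_n$ such that \[ \|A-R\|_1\leq 26\,\Gamma_1(A)^{1/3}. \] Moreover, such an $R$ can be computed in polynomial time. In addition, if $A$ is binary, then there exists a binary matrix $R$ satisfying these conditions.
   Context: For a positive integer $n$, $\mathcal{A}_n$ denotes the set of all symmetric $n\times n$ real matrices with entries in $[0,1]$. A matrix is binary if all its entries lie in $\{0,1\}$. The normalized $\ell^1$-norm of an $n\times n$ matrix $A$ is $\|A\|_1=\frac{1}{n^2}\sum_{i,j=1}^n|A_{i,j}|$. An $n\times n$ symmetric matrix $A$ is a Robinson matrix if for all $1\le i<j<k\le n$ we have $A_{i,j}\ge A_{i,k}$ and $A_{j,k}\ge A_{i,k}$. For $x\in\mathbb{R}$ let $[x]_+=\max(x,0)$. For a symmetric $n\times n$ matrix $A$, \[ \Gamma_1(A)=\frac{1}{n^3}\sum_{1\le i<k<j\le n}\Big([A_{i,j}-A_{i,k}]_+ + [A_{i,j}-A_{k,j}]_+\Big). \] *)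

theory Defs
  imports Complex_Main "Jordan_Normal_Form.Matrix" "HOL-Computational_Algebra.Polynomial"
begin

section \<open>Robinson matrices\<close>

text \<open>
  Library matrices are indexed from 0, so the index range 1, ..., n becomes 0, ..., n - 1.
\<close>

definition sym_unit_mats :: "nat \<Rightarrow> real mat set" where
  "sym_unit_mats n =
     {A \<in> carrier_mat n n. transpose_mat A = A \<and> elements_mat A \<subseteq> {0..1}}"

definition binary_mat :: "real mat \<Rightarrow> bool" where
  "binary_mat A \<longleftrightarrow> elements_mat A \<subseteq> {0, 1}"

definition norm1_mat :: "real mat \<Rightarrow> real" where
  "norm1_mat A = (\<Sum>i<dim_row A. \<Sum>j<dim_col A. \<bar>A $$ (i, j)\<bar>) / real (dim_row A) ^ 2"

definition robinson :: "real mat \<Rightarrow> bool" where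
  "robinson A \<longleftrightarrow> transpose_mat A = A \<and>
     (\<forall>i j k. i < j \<and> j < k \<and> k < dim_row A \<longrightarrow>
        A $$ (i, j) \<ge> A $$ (i, k) \<and> A $$ (j, k) \<ge> A $$ (i, k))"

definition pos_part :: "real \<Rightarrow> real" where
  "pos_part x = max x 0"

definition Gamma1 :: "real mat \<Rightarrow> real" where
  "Gamma1 A =
     (\<Sum>j<dim_row A. \<Sum>k<j. \<Sum>i<k.
        pos_part (A $$ (i, j) - A $$ (i, k)) + pos_part (A $$ (i, j) - A $$ (k, j)))
     / real (dim_row A) ^ 3"


section \<open>Polynomial time for real matrices\<close>

text \<open>
  The model of computation is a real RAM, programmed by while programs. Index registers hold
  natural numbers and are used for control and for addressing; real numbers live in an unbounded
  memory whose cells are addressed by an array name and two indices. Each elementary instruction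
  and each evaluation of a test costs one step.

  Only additions, subtractions and comparisons are available, and the constants are natural and
  rational numbers. Hence t steps increase the bit length of the numbers involved by O(t) only: a
  polynomial number of steps also means polynomial time on a Turing machine if the entries of the
  input are rational, and polynomial time in the Blum-Shub-Smale model if they are real.
\<close>

record state =
  idx :: "nat \<Rightarrow> nat"
  arr :: "nat \<times> nat \<times> nat \<Rightarrow> real"

text \<open>
  \<open>Cell a i j\<close> denotes the entry of the array named \<open>a\<close> whose row and column are the current
  contents of the index registers named \<open>i\<close> and \<open>j\<close>.
\<close>

datatype cell = Cell nat nat nat

primrec addr :: "state \<Rightarrow> cell \<Rightarrow> nat \<times> nat \<times> nat" where
  "addr s (Cell a i j) = (a, idx s i, idx s j)"

datatype test =
    IdxLess nat nat
  | RealLess cell cell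

primrec holds :: "test \<Rightarrow> state \<Rightarrow> bool" where
  "holds (IdxLess u v) s \<longleftrightarrow> idx s u < idx s v"
| "holds (RealLess x y) s \<longleftrightarrow> arr s (addr s x) < arr s (addr s y)"

datatype instr =
    IdxConst nat nat
  | IdxAdd nat nat nat
  | IdxSub nat nat nat
  | RealConst cell rat
  | RealAdd cell cell cell
  | RealSub cell cell cell

text \<open>
  The first argument of an instruction is its target. \<open>IdxSub\<close> is truncated subtraction.
\<close>

primrec run_instr :: "instr \<Rightarrow> state \<Rightarrow> state" where
  "run_instr (IdxConst w m) s = s\<lparr>idx := (idx s)(w := m)\<rparr>"
| "run_instr (IdxAdd w u v) s = s\<lparr>idx := (idx s)(w := idx s u + idx s v)\<rparr>"
| "run_instr (IdxSub w u v) s = s\<lparr>idx := (idx s)(w := idx s u - idx s v)\<rparr>"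
| "run_instr (RealConst z q) s = s\<lparr>arr := (arr s)(addr s z := of_rat q)\<rparr>"
| "run_instr (RealAdd z x y) s =
     s\<lparr>arr := (arr s)(addr s z := arr s (addr s x) + arr s (addr s y))\<rparr>"
| "run_instr (RealSub z x y) s =
     s\<lparr>arr := (arr s)(addr s z := arr s (addr s x) - arr s (addr s y))\<rparr>"

datatype prog =
    Instr instr
  | Seq prog prog
  | Cond test prog prog
  | Loop test prog

text \<open>
  \<open>exec c s t s'\<close>: started in \<open>s\<close>, the program \<open>c\<close> halts after exactly \<open>t\<close> steps in \<open>s'\<close>.
\<close>

inductive exec :: "prog \<Rightarrow> state \<Rightarrow> nat \<Rightarrow> state \<Rightarrow> bool" where
  Instr: "exec (Instr a) s 1 (run_instr a s)"
| Seq: "exec c s t s' \<Longrightarrow> exec d s' u s'' \<Longrightarrow> exec (Seq c d) s (t + u) s''"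
| CondTrue: "holds b s \<Longrightarrow> exec c s t s' \<Longrightarrow> exec (Cond b c d) s (Suc t) s'"
| CondFalse: "\<not> holds b s \<Longrightarrow> exec d s t s' \<Longrightarrow> exec (Cond b c d) s (Suc t) s'"
| LoopFalse: "\<not> holds b s \<Longrightarrow> exec (Loop b c) s 1 s"
| LoopTrue: "holds b s \<Longrightarrow> exec c s t s' \<Longrightarrow> exec (Loop b c) s' u s'' \<Longrightarrow>
    exec (Loop b c) s (Suc (t + u)) s''"

lemma exec_deterministic:
  "exec c s t s' \<Longrightarrow> exec c s u s'' \<Longrightarrow> u = t \<and> s'' = s'"
proof (induction arbitrary: u s'' rule: exec.induct)
  case (Instr a s)
  then show ?case by (auto elim: exec.cases)
next
  case (Seq c s t s' d v r)
  from Seq.prems show ?case by (cases rule: exec.cases) (use Seq.IH in blast)+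
next
  case (CondTrue b s c t s' d)
  from CondTrue.prems show ?case
    by (cases rule: exec.cases) (use CondTrue.IH CondTrue.hyps in blast)+
next
  case (CondFalse b s d t s' c)
  from CondFalse.prems show ?case
    by (cases rule: exec.cases) (use CondFalse.IH CondFalse.hyps in blast)+
next
  case (LoopFalse b s c)
  from LoopFalse.prems show ?case
    by (cases rule: exec.cases) (use LoopFalse.hyps in auto)
next
  case (LoopTrue b s c t s' v r)
  from LoopTrue.prems show ?case
    by (cases rule: exec.cases) (use LoopTrue.IH LoopTrue.hyps in blast)+
qed

text \<open>
  The size n is passed in index register 0 and the input matrix in array 0; everything else is 0.
  The output matrix is read off array 1.
\<close>

definition input_state :: "nat \<Rightarrow> real mat \<Rightarrow> state" where
  "input_state n A =
     \<lparr>idx = (\<lambda>r. if r = 0 then n else 0),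
      arr = (\<lambda>(a, i, j). if a = 0 \<and> i < n \<and> j < n then A $$ (i, j) else 0)\<rparr>"

definition output_mat :: "nat \<Rightarrow> state \<Rightarrow> real mat" where
  "output_mat n s = mat n n (\<lambda>(i, j). arr s (1, i, j))"

text \<open>
  \<open>poly_time_computable I Q\<close>: a single program computes, for every n and every n \<open>\<times>\<close> n matrix
  \<open>A \<in> I n\<close>, some n \<open>\<times>\<close> n matrix \<open>R\<close> with \<open>Q n A R\<close>, in a number of steps polynomial in n.
\<close>

definition poly_time_computable ::
  "(nat \<Rightarrow> real mat set) \<Rightarrow> (nat \<Rightarrow> real mat \<Rightarrow> real mat \<Rightarrow> bool) \<Rightarrow> bool" where
  "poly_time_computable I Q \<longleftrightarrow>
     (\<exists>(c :: prog) (p :: nat poly). \<forall>n\<ge>1. \<forall>A\<in>I n. \<exists>t s.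
        exec c (input_state n A) t s \<and> t \<le> poly p n \<and> Q n A (output_mat n s))"

end

theory Submission
  imports Defs "HOL-Analysis.Henstock_Kurzweil_Integration"
begin

text \<open>
  For i < j let R(i, j) be the k-th largest entry of A in the quadrant of all (p, q) with
  p \<le> i and j \<le> q, or 0 if this quadrant has fewer than k entries. The quadrants shrink
  away from the diagonal, so R is a Robinson matrix.

  If R(i, j) > A(i, j), then k entries A(p, q) of the quadrant are at least R(i, j), and each of them
  yields a violation of the Robinson inequalities at the corner (p, j). Counting multiplicities
  bounds the sum of R - A over i < j by n^4 \<Gamma> / k.

  Conversely, every point of the level set R \<le> t < A has fewer than k points of this set in its
  quadrant. Cut the square into boxes of side m. On a diagonal of boxes, all points outside the
  innermost nonempty box lie in the quadrant of a point of this box, so the level set has at most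
  m^2 + k points there, and O((n / m) (m^2 + k)) points in total. Integration over t bounds the sum of
  A - R in the same way. With k = m^2 and m = \<lceil>n \<Gamma>^(1/3)\<rceil> both parts add up to the claim.
  If n \<Gamma>^(1/3) \<le> 1, then k = 1, where A - R \<le> 0 replaces the estimate by level sets.

  The program tries every k \<le> n^2 and keeps the best, so it need not know \<Gamma>.
\<close>

section \<open>Approximation by k-th largest entries\<close>

definition outer :: "nat \<Rightarrow> nat \<Rightarrow> nat \<Rightarrow> (nat \<times> nat) set" where
  "outer n i j = {..i} \<times> {j..<n}"

text \<open>Counting the points of at least the same value describes the k-th largest entry with
  multiplicities and without sorting, in the form in which \<open>count_prog\<close> and
  \<open>rank_prog\<close> evaluate it. For \<open>k = 0\<close> and \<open>k = 1\<close> every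
  point of the quadrant qualifies.\<close>

definition rank_pts :: "nat \<Rightarrow> (nat \<Rightarrow> nat \<Rightarrow> real) \<Rightarrow> nat \<Rightarrow> nat \<Rightarrow> nat \<Rightarrow> (nat \<times> nat) set" where
  "rank_pts n f k i j =
     {(p, q) \<in> outer n i j. k \<le> card {(p', q') \<in> outer n i j. f p q \<le> f p' q'}}"

text \<open>The 0 keeps the maximum defined if no point qualifies. For nonnegative \<open>f\<close>
  it alters no other maximum, and it is an admissible value for binary \<open>f\<close>.\<close>

definition rank_val :: "nat \<Rightarrow> (nat \<Rightarrow> nat \<Rightarrow> real) \<Rightarrow> nat \<Rightarrow> nat \<Rightarrow> nat \<Rightarrow> real" where
  "rank_val n f k i j = Max (insert 0 (case_prod f ` rank_pts n f k i j))"

text \<open>The Robinson inequalities compare off-diagonal entries only, so the diagonal can be kept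
  and costs nothing.\<close>

definition robinson_fit :: "nat \<Rightarrow> (nat \<Rightarrow> nat \<Rightarrow> real) \<Rightarrow> nat \<Rightarrow> nat \<Rightarrow> nat \<Rightarrow> real" where
  "robinson_fit n f k i j = (if i = j then f i j else rank_val n f k (min i j) (max i j))"

definition upper_pairs :: "nat \<Rightarrow> (nat \<times> nat) set" where
  "upper_pairs n = {(i, j). i < j \<and> j < n}"

lemma finite_outer [simp]: "finite (outer n i j)"
  by (simp add: outer_def)

lemma finite_rank_pts [simp]: "finite (rank_pts n f k i j)"
  by (rule finite_subset[OF _ finite_outer]) (auto simp: rank_pts_def)

lemma finite_upper_pairs [simp]: "finite (upper_pairs n)"
  by (rule finite_subset[of _ "{..<n} \<times> {..<n}"]) (auto simp: upper_pairs_def)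

lemma rank_val_cases:
  "rank_val n f k i j = 0 \<or>
   (\<exists>p q. (p, q) \<in> rank_pts n f k i j \<and> rank_val n f k i j = f p q)"
proof -
  have "rank_val n f k i j \<in> insert 0 (case_prod f ` rank_pts n f k i j)"
    unfolding rank_val_def by (rule Max_in) auto
  then show ?thesis by auto
qed

lemma rank_val_ge: "(p, q) \<in> rank_pts n f k i j \<Longrightarrow> f p q \<le> rank_val n f k i j"
  unfolding rank_val_def by (rule Max_ge) (auto intro: rev_image_eqI)

lemma rank_val_nonneg: "0 \<le> rank_val n f k i j"
  unfolding rank_val_def by (rule Max_ge) auto

text \<open>The source of the Robinson property: a point with \<open>k\<close> points of at least
  its value in the smaller quadrant has them in the larger one too, so the candidates for the
  maximum can only increase.\<close>

lemma rank_val_antimono: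
  assumes "i' \<le> i" "j \<le> j'"
  shows "rank_val n f k i' j' \<le> rank_val n f k i j"
proof -
  have sub: "outer n i' j' \<subseteq> outer n i j"
    using assms by (auto simp: outer_def)
  have "rank_pts n f k i' j' \<subseteq> rank_pts n f k i j"
  proof (clarify)
    fix p q assume "(p, q) \<in> rank_pts n f k i' j'"
    then have "(p, q) \<in> outer n i' j'"
        "k \<le> card {(p', q') \<in> outer n i' j'. f p q \<le> f p' q'}"
      by (auto simp: rank_pts_def)
    moreover have "card {(p', q') \<in> outer n i' j'. f p q \<le> f p' q'}
        \<le> card {(p', q') \<in> outer n i j. f p q \<le> f p' q'}"
      by (rule card_mono, rule finite_subset[OF _ finite_outer]) (use sub in auto)
    ultimately show "(p, q) \<in> rank_pts n f k i j"
      using sub by (auto simp: rank_pts_def)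
  qed
  then show ?thesis
    unfolding rank_val_def by (intro Max_mono) auto
qed

text \<open>The point \<open>(i, j)\<close> lies in its own quadrant and counts itself, so
  \<open>k = 1\<close> leaves no deficit.\<close>

lemma rank_val_one_ge:
  assumes "(i, j) \<in> upper_pairs n"
  shows "f i j \<le> rank_val n f 1 i j"
proof (rule rank_val_ge)
  have ij: "(i, j) \<in> outer n i j"
    using assms by (auto simp: outer_def upper_pairs_def)
  have "finite {(p', q') \<in> outer n i j. f i j \<le> f p' q'}"
    by (rule finite_subset[OF _ finite_outer]) auto
  moreover have "(i, j) \<in> {(p', q') \<in> outer n i j. f i j \<le> f p' q'}"
    using ij by auto
  ultimately have "card {(p', q') \<in> outer n i j. f i j \<le> f p' q'} > 0"
    by (subst card_gt_0_iff) blast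
  then show "(i, j) \<in> rank_pts n f 1 i j"
    using ij by (auto simp: rank_pts_def)
qed

text \<open>If \<open>k\<close> points of the quadrant were above \<open>t\<close>, the one of least
  value among them would belong to \<open>rank_pts\<close>, and the k-th largest value would exceed
  \<open>t\<close>.\<close>

lemma card_outer_above_level:
  assumes ij: "(i, j) \<in> upper_pairs n" and t: "rank_val n f k i j \<le> t" "t < f i j"
  shows "card {(p, q) \<in> outer n i j. t < f p q} < k"
proof (rule ccontr)
  assume large: "\<not> ?thesis"
  define S where "S = {(p, q) \<in> outer n i j. t < f p q}"
  have fin: "finite S"
    by (rule finite_subset[OF _ finite_outer[of n i j]]) (auto simp: S_def)
  have "(i, j) \<in> S" using ij t by (auto simp: S_def outer_def upper_pairs_def)
  then have "Min (case_prod f ` S) \<in> case_prod f ` S"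
    using fin by (intro Min_in) auto
  then obtain p q where pq: "(p, q) \<in> S" "f p q = Min (case_prod f ` S)" by auto
  have "S \<subseteq> {(p', q') \<in> outer n i j. f p q \<le> f p' q'}"
    using fin by (auto simp: pq(2) S_def intro!: Min_le rev_image_eqI)
  then have "card S \<le> card {(p', q') \<in> outer n i j. f p q \<le> f p' q'}"
    by (intro card_mono finite_subset[OF _ finite_outer[of n i j]]) auto
  with large pq(1) have "(p, q) \<in> rank_pts n f k i j"
    by (auto simp: rank_pts_def S_def)
  from rank_val_ge[OF this] pq(1) t(1) show False by (auto simp: S_def)
qed

section \<open>Counting points on diagonals of boxes\<close>

lemma card_box_le:
  assumes "0 < m" "\<And>i j. (i, j) \<in> B \<Longrightarrow> i div m = a \<and> j div m = b"
  shows "card B \<le> m ^ 2"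
proof -
  have "B \<subseteq> {a * m..<a * m + m} \<times> {b * m..<b * m + m}"
  proof (rule subrelI)
    fix i j assume "(i, j) \<in> B"
    then have "i div m = a" "j div m = b" using assms(2) by auto
    then have "i = a * m + i mod m" "j = b * m + j mod m"
      by (metis div_mult_mod_eq)+
    moreover have "i mod m < m" "j mod m < m" using assms(1) by auto
    ultimately have "a * m \<le> i \<and> i < a * m + m" "b * m \<le> j \<and> j < b * m + m"
      by linarith+
    then show "(i, j) \<in> {a * m..<a * m + m} \<times> {b * m..<b * m + m}" by simp
  qed
  then have "card B \<le> card ({a * m..<a * m + m} \<times> {b * m..<b * m + m})"
    by (intro card_mono) auto
  then show ?thesis by (simp add: power2_eq_square)
qed

text \<open>On boxes with constant index sum, a smaller box row forces a larger box column. So with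
  \<open>(i, j)\<close> in the nonempty box of largest row, all points of other boxes have strictly
  smaller row and strictly larger column and lie in the quadrant of \<open>(i, j)\<close>; that box
  itself has at most \<open>m^2\<close> points.\<close>

lemma card_diagonal_le:
  assumes m: "0 < m" and E: "E \<subseteq> {..<n} \<times> {..<n}"
    and few: "\<And>i j. (i, j) \<in> E \<Longrightarrow> card (E \<inter> outer n i j) < k"
  shows "card {(i, j) \<in> E. i div m + j div m = d} \<le> m ^ 2 + k"
proof -
  define F where "F = {(i, j) \<in> E. i div m + j div m = d}"
  have finE: "finite E" using E by (rule finite_subset) auto
  have finF: "finite F" using finE by (rule rev_finite_subset) (auto simp: F_def)
  show ?thesis
  proof (cases "F = {}")
    case True
    then show ?thesis by (simp only: F_def[symmetric]) simp
  next
    case False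
    define a where "a = Max ((\<lambda>(i, j). i div m) ` F)"
    have "a \<in> (\<lambda>(i, j). i div m) ` F"
      unfolding a_def using False finF by (intro Max_in) auto
    then obtain i j where ij: "(i, j) \<in> F" "i div m = a" by auto
    have le: "p div m \<le> a" if "(p, q) \<in> F" for p q
      unfolding a_def using that finF by (intro Max_ge) (auto intro!: rev_image_eqI)
    define B where "B = {(p, q) \<in> F. p div m = a}"
    have "F \<subseteq> B \<union> (E \<inter> outer n i j)"
    proof clarify
      fix p q assume pq: "(p, q) \<in> F" "(p, q) \<notin> E \<inter> outer n i j"
      have "p div m + q div m = i div m + j div m"
        using pq(1) ij by (auto simp: F_def)
      have "p div m = a"
      proof (rule ccontr)
        assume "p div m \<noteq> a"
        with le[OF pq(1)] have less: "p div m < i div m" using ij by simp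
        with \<open>p div m + q div m = i div m + j div m\<close> have "j div m < q div m" by linarith
        with less have "p < i" "j < q"
          by (meson div_le_mono leD leI)+
        with pq E show False by (auto simp: F_def outer_def)
      qed
      then show "(p, q) \<in> B" using pq by (auto simp: B_def)
    qed
    then have "card F \<le> card (B \<union> (E \<inter> outer n i j))"
      using finF finE by (intro card_mono) (auto simp: B_def intro: rev_finite_subset[OF finF])
    also have "\<dots> \<le> card B + card (E \<inter> outer n i j)" by (rule card_Un_le)
    also have "card B \<le> m ^ 2"
      by (rule card_box_le[OF m, of _ a "d - a"]) (auto simp: B_def F_def)
    also have "card (E \<inter> outer n i j) \<le> k"
      using few[of i j] ij by (auto simp: F_def)
    finally show ?thesis by (simp add: F_def)
  qed
qed

text \<open>Box indices range over \<open>0, ..., (n - 1) div m\<close>, so the factor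
  \<open>2 * ((n - 1) div m) + 1\<close> is the number of possible index sums
  \<open>d\<close>.\<close>

lemma card_few_dominators_le:
  assumes m: "0 < m" and E: "E \<subseteq> {..<n} \<times> {..<n}"
    and few: "\<And>i j. (i, j) \<in> E \<Longrightarrow> card (E \<inter> outer n i j) < k"
  shows "card E \<le> (2 * ((n - 1) div m) + 1) * (m ^ 2 + k)"
proof -
  let ?D = "{..2 * ((n - 1) div m)}"
  have "E \<subseteq> (\<Union>d\<in>?D. {(i, j) \<in> E. i div m + j div m = d})"
  proof clarify
    fix i j assume "(i, j) \<in> E"
    moreover from this E have "i div m \<le> (n - 1) div m" "j div m \<le> (n - 1) div m"
      by (auto intro!: div_le_mono)
    ultimately show "(i, j) \<in> (\<Union>d\<in>?D. {(i, j) \<in> E. i div m + j div m = d})" by auto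
  qed
  moreover have "finite E" using E by (rule finite_subset) auto
  ultimately have "card E \<le> card (\<Union>d\<in>?D. {(i, j) \<in> E. i div m + j div m = d})"
    by (intro card_mono) (auto elim: rev_finite_subset)
  also have "\<dots> \<le> (\<Sum>d\<in>?D. card {(i, j) \<in> E. i div m + j div m = d})"
    by (rule card_UN_le) simp
  also have "\<dots> \<le> (\<Sum>d\<in>?D. m ^ 2 + k)"
    using card_diagonal_le[OF assms] by (intro sum_mono)
  finally show ?thesis by simp
qed

section \<open>Deficit: integration over level sets\<close>

text \<open>Layer cake formula: a positive part is the length of \<open>{b x..<a x}\<close>, which
  lies in the unit interval by \<open>range\<close>, and the sum of the indicators at
  \<open>t\<close> counts the intervals containing \<open>t\<close>.\<close>

lemma sum_gaps_le_cover:
  fixes a b :: "'a \<Rightarrow> real"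
  assumes fin: "finite P" and range: "\<And>x. x \<in> P \<Longrightarrow> 0 \<le> b x \<and> a x \<le> 1"
    and cover: "\<And>t. 0 \<le> t \<Longrightarrow> real (card {x \<in> P. b x \<le> t \<and> t < a x}) \<le> N"
  shows "(\<Sum>x\<in>P. pos_part (a x - b x)) \<le> N"
proof -
  have gap: "((indicat_real {b x..<a x}) has_integral pos_part (a x - b x)) {0..1}"
    if "x \<in> P" for x
  proof (cases "b x < a x")
    case True
    have "((\<lambda>t. 1 :: real) has_integral (a x - b x)) {b x..a x}"
      using has_integral_const_real[of "1::real" "b x" "a x"] True by simp
    \<comment> \<open>The half-open interval, which matches the level sets of
      \<open>card_outer_above_level\<close>, differs from the closed one in a single point.\<close>
    then have "((indicat_real {b x..<a x}) has_integral (a x - b x)) {b x..a x}"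
      by (rule has_integral_spike_finite[of "{a x}", rotated 2]) (auto simp: indicator_def)
    then have "((indicat_real {b x..<a x}) has_integral (a x - b x)) {0..1}"
      by (rule has_integral_on_superset) (use range[OF that] in \<open>auto simp: indicator_def\<close>)
    then show ?thesis using True by (simp add: pos_part_def max_def)
  next
    case False
    then have "indicat_real {b x..<a x} = (\<lambda>_. 0)" by (simp add: indicator_def fun_eq_iff)
    then show ?thesis using False by (simp add: pos_part_def max_def)
  qed
  have "((\<lambda>t. \<Sum>x\<in>P. indicat_real {b x..<a x} t) has_integral
      (\<Sum>x\<in>P. pos_part (a x - b x))) {0..1}"
    by (intro has_integral_sum fin gap)
  moreover have "((\<lambda>t. N) has_integral N) {0..1::real}"
    using has_integral_const_real[of N 0 "1::real"] by simp
  moreover have "(\<Sum>x\<in>P. indicat_real {b x..<a x} t) \<le> N" if "t \<in> {0..1}" for t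
  proof -
    have "(\<Sum>x\<in>P. indicat_real {b x..<a x} t) = (\<Sum>x\<in>P. if b x \<le> t \<and> t < a x then 1 else 0)"
      by (intro sum.cong) (auto simp: indicator_def)
    also have "\<dots> = real (card {x \<in> P. b x \<le> t \<and> t < a x})"
      using fin by (simp add: sum.If_cases Int_def)
    finally show ?thesis using cover[of t] that by simp
  qed
  ultimately show ?thesis by (rule has_integral_le)
qed

text \<open>At each level \<open>t\<close>, the level set meets the quadrant of each of its points
  in fewer than \<open>k\<close> points, so one bound holds for all \<open>t\<close>.\<close>

lemma sum_deficit_le:
  assumes "0 < m" and f: "\<And>i j. i < n \<Longrightarrow> j < n \<Longrightarrow> f i j \<le> 1"
  shows "(\<Sum>(i, j)\<in>upper_pairs n. pos_part (f i j - rank_val n f k i j))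
    \<le> real ((2 * ((n - 1) div m) + 1) * (m ^ 2 + k))"
proof -
  have "(\<Sum>x\<in>upper_pairs n. pos_part (case_prod f x - case_prod (rank_val n f k) x))
    \<le> real ((2 * ((n - 1) div m) + 1) * (m ^ 2 + k))"
  proof (rule sum_gaps_le_cover)
    fix t :: real
    define E where "E = {x \<in> upper_pairs n. case_prod (rank_val n f k) x \<le> t \<and> t < case_prod f x}"
    have "card (E \<inter> outer n i j) < k" if "(i, j) \<in> E" for i j
    proof -
      have "card (E \<inter> outer n i j) \<le> card {(p, q) \<in> outer n i j. t < f p q}"
        by (intro card_mono finite_subset[OF _ finite_outer[of n i j]]) (auto simp: E_def)
      also have "\<dots> < k"
        by (rule card_outer_above_level) (use that in \<open>auto simp: E_def\<close>)
      finally show ?thesis .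
    qed
    moreover have "E \<subseteq> {..<n} \<times> {..<n}" by (auto simp: E_def upper_pairs_def)
    ultimately have "card E \<le> (2 * ((n - 1) div m) + 1) * (m ^ 2 + k)"
      using \<open>0 < m\<close> by (intro card_few_dominators_le)
    then show "real (card {x \<in> upper_pairs n. case_prod (rank_val n f k) x \<le> t \<and> t < case_prod f x})
      \<le> real ((2 * ((n - 1) div m) + 1) * (m ^ 2 + k))"
      unfolding E_def of_nat_le_iff .
  next
    fix x assume "x \<in> upper_pairs n"
    then show "0 \<le> case_prod (rank_val n f k) x \<and> case_prod f x \<le> 1"
      by (auto intro: f rank_val_nonneg simp: upper_pairs_def)
  qed simp
  then show ?thesis by (simp add: case_prod_unfold)
qed

section \<open>Excess: charging to violations\<close>

text \<open>At least \<open>k\<close> points of the quadrant have a value no smaller than an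
  attained k-th largest value, and each of them contributes at least the excess to the right-hand
  side.\<close>

lemma excess_le:
  assumes ij: "0 \<le> f i j"
  shows "real k * pos_part (rank_val n f k i j - f i j)
    \<le> (\<Sum>(p, q)\<in>outer n i j. pos_part (f p q - f i j))"
proof -
  let ?r = "rank_val n f k i j"
  have nonneg: "0 \<le> (\<Sum>(p, q)\<in>outer n i j. pos_part (f p q - f i j))"
    by (intro sum_nonneg) (auto simp: pos_part_def)
  from rank_val_cases[of n f k i j] show ?thesis
  proof
    \<comment> \<open>The default value 0 cannot exceed a nonnegative entry, so there is no
      excess.\<close>
    assume "?r = 0"
    with ij nonneg show ?thesis by (simp add: pos_part_def)
  next
    assume "\<exists>p q. (p, q) \<in> rank_pts n f k i j \<and> ?r = f p q"
    then obtain p q where pq: "(p, q) \<in> rank_pts n f k i j" "?r = f p q" by blast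
    define S where "S = {(p', q') \<in> outer n i j. ?r \<le> f p' q'}"
    have "k \<le> card S" using pq by (simp add: rank_pts_def S_def)
    then have "real k * pos_part (?r - f i j) \<le> (\<Sum>(p, q)\<in>S. pos_part (?r - f i j))"
      by (auto simp: pos_part_def case_prod_unfold intro!: mult_right_mono)
    also have "\<dots> \<le> (\<Sum>(p, q)\<in>S. pos_part (f p q - f i j))"
      by (intro sum_mono) (auto simp: S_def pos_part_def)
    also have "\<dots> \<le> (\<Sum>(p, q)\<in>outer n i j. pos_part (f p q - f i j))"
      by (intro sum_mono2) (auto simp: S_def pos_part_def)
    finally show ?thesis .
  qed
qed

text \<open>This is \<open>Gamma1\<close> without the factor \<open>1 / n^3\<close>, for a function
  in place of a matrix.\<close>

definition violation :: "nat \<Rightarrow> (nat \<Rightarrow> nat \<Rightarrow> real) \<Rightarrow> real" where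
  "violation n f = (\<Sum>j<n. \<Sum>k<j. \<Sum>i<k. pos_part (f i j - f i k) + pos_part (f i j - f k j))"

text \<open>Any (p, q) with p \<le> i < j \<le> q is joined to (i, j) through the corner (p, j).\<close>

lemma sum_outer_le_viol:
  "(\<Sum>(i, j)\<in>upper_pairs n. \<Sum>(p, q)\<in>outer n i j. pos_part (f p q - f i j)) \<le> real n * violation n f"
proof -
  let ?T = "{(p, j, q). p < j \<and> j < q \<and> q < n}"
  have finT: "finite ?T"
    by (rule finite_subset[of _ "{..<n} \<times> {..<n} \<times> {..<n}"]) auto
  have viol: "violation n f = (\<Sum>(p, j, q)\<in>?T. pos_part (f p q - f p j))
      + (\<Sum>(p, j, q)\<in>?T. pos_part (f p q - f j q))"
  proof -
    have "violation n f = (\<Sum>x\<in>(SIGMA q:{..<n}. SIGMA j:{..<q}. {..<j}).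
        (\<lambda>(q, j, p). pos_part (f p q - f p j) + pos_part (f p q - f j q)) x)"
      by (simp add: violation_def sum.Sigma case_prod_unfold)
    also have "\<dots> = (\<Sum>(p, j, q)\<in>?T. pos_part (f p q - f p j) + pos_part (f p q - f j q))"
      by (rule sum.reindex_bij_witness[of _ "\<lambda>(p, j, q). (q, j, p)" "\<lambda>(q, j, p). (p, j, q)"]) auto
    finally show ?thesis by (simp add: case_prod_unfold sum.distrib)
  qed
  define X where "X = (SIGMA x:upper_pairs n. outer n (fst x) (snd x))"
  have finX: "finite X" unfolding X_def by auto
  \<comment> \<open>The path through the corner splits the difference into a row part
    \<open>g\<close>, independent of \<open>i\<close>, and a column part \<open>h\<close>,
    independent of \<open>q\<close>; the positive part is subadditive.\<close>
  define g where "g = (\<lambda>((i::nat, j), (p, q)). pos_part (f p q - f p j))"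
  define h where "h = (\<lambda>((i, j), (p, q::nat)). pos_part (f p j - f i j) :: real)"
  have "(\<Sum>(i, j)\<in>upper_pairs n. \<Sum>(p, q)\<in>outer n i j. pos_part (f p q - f i j))
      = (\<Sum>((i, j), (p, q))\<in>X. pos_part (f p q - f i j))"
    by (simp add: X_def sum.Sigma case_prod_unfold)
  also have "\<dots> \<le> (\<Sum>x\<in>X. g x + h x)"
    by (intro sum_mono) (auto simp: g_def h_def pos_part_def)
  also have "\<dots> = (\<Sum>x\<in>X. g x) + (\<Sum>x\<in>X. h x)" by (rule sum.distrib)
  also have "(\<Sum>x\<in>X. g x) \<le> (\<Sum>(i, p, j, q)\<in>{..<n} \<times> ?T. pos_part (f p q - f p j))"
  proof -
    \<comment> \<open>Terms with \<open>q = j\<close> vanish. The others are indexed injectively by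
      a triple \<open>p < j < q\<close> and a free index \<open>i < n\<close>, so each triple occurs
      at most \<open>n\<close> times.\<close>
    have "(\<Sum>x\<in>X. g x) = (\<Sum>x\<in>{x \<in> X. snd (fst x) < snd (snd x)}. g x)"
      by (rule sum.mono_neutral_right[OF finX])
        (auto simp: X_def g_def outer_def pos_part_def le_eq_less_or_eq)
    also have "\<dots> = (\<Sum>(i, p, j, q)\<in>(\<lambda>((i, j), (p, q)). (i, p, j, q)) `
        {x \<in> X. snd (fst x) < snd (snd x)}. pos_part (f p q - f p j))"
      by (subst sum.reindex) (auto simp: inj_on_def g_def case_prod_unfold intro!: sum.cong)
    also have "\<dots> \<le> (\<Sum>(i, p, j, q)\<in>{..<n} \<times> ?T. pos_part (f p q - f p j))"
      by (rule sum_mono2) (auto simp: finT X_def upper_pairs_def outer_def pos_part_def)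
    finally show ?thesis .
  qed
  also have "(\<Sum>x\<in>X. h x) \<le> (\<Sum>(q, p, i, j)\<in>{..<n} \<times> ?T. pos_part (f p j - f i j))"
  proof -
    \<comment> \<open>Terms with \<open>p = i\<close> vanish; now the triple is
      \<open>p < i < j\<close> and \<open>q < n\<close> is free.\<close>
    have "(\<Sum>x\<in>X. h x) = (\<Sum>x\<in>{x \<in> X. fst (snd x) < fst (fst x)}. h x)"
      by (rule sum.mono_neutral_right[OF finX])
        (auto simp: X_def h_def outer_def pos_part_def le_eq_less_or_eq)
    also have "\<dots> = (\<Sum>(q, p, i, j)\<in>(\<lambda>((i, j), (p, q)). (q, p, i, j)) `
        {x \<in> X. fst (snd x) < fst (fst x)}. pos_part (f p j - f i j))"
      by (subst sum.reindex) (auto simp: inj_on_def h_def case_prod_unfold intro!: sum.cong)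
    also have "\<dots> \<le> (\<Sum>(q, p, i, j)\<in>{..<n} \<times> ?T. pos_part (f p j - f i j))"
      by (rule sum_mono2) (auto simp: finT X_def upper_pairs_def outer_def pos_part_def)
    finally show ?thesis .
  qed
  \<comment> \<open>The row parts give \<open>n\<close> times the first half of
    \<open>violation\<close>, and the column parts, after renaming the triple, \<open>n\<close>
    times the second.\<close>
  also have "(\<Sum>(i, p, j, q)\<in>{..<n} \<times> ?T. pos_part (f p q - f p j))
      + (\<Sum>(q, p, i, j)\<in>{..<n} \<times> ?T. pos_part (f p j - f i j)) = real n * violation n f"
  proof -
    have copies: "(\<Sum>y\<in>{..<n} \<times> ?T. w (snd y)) = real n * (\<Sum>x\<in>?T. w x)" for w
      using sum.cartesian_product[of "\<lambda>_. w" ?T "{..<n}"] by (simp add: case_prod_unfold)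
    show ?thesis
      using copies[of "\<lambda>x. pos_part (f (fst x) (snd (snd x)) - f (fst x) (fst (snd x)))"]
        copies[of "\<lambda>x. pos_part (f (fst x) (snd (snd x)) - f (fst (snd x)) (snd (snd x)))"]
      by (simp add: viol case_prod_unfold distrib_left)
  qed
  finally show ?thesis by simp
qed

lemma sum_excess_le:
  assumes "\<And>i j. i < n \<Longrightarrow> j < n \<Longrightarrow> 0 \<le> f i j"
  shows "real k * (\<Sum>(i, j)\<in>upper_pairs n. pos_part (rank_val n f k i j - f i j)) \<le> real n * violation n f"
proof -
  have "real k * (\<Sum>(i, j)\<in>upper_pairs n. pos_part (rank_val n f k i j - f i j))
     = (\<Sum>(i, j)\<in>upper_pairs n. real k * pos_part (rank_val n f k i j - f i j))"
    by (simp add: sum_distrib_left case_prod_unfold)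
  also have "\<dots> \<le> (\<Sum>(i, j)\<in>upper_pairs n. \<Sum>(p, q)\<in>outer n i j. pos_part (f p q - f i j))"
    by (intro sum_mono) (auto simp: upper_pairs_def intro!: excess_le assms)
  finally show ?thesis using sum_outer_le_viol[of f n] by linarith
qed

section \<open>Cost of a fit and choice of k\<close>

text \<open>Unnormalized, so that the program can compute it by additions and subtractions.\<close>

definition fit_cost :: "nat \<Rightarrow> (nat \<Rightarrow> nat \<Rightarrow> real) \<Rightarrow> nat \<Rightarrow> real" where
  "fit_cost n f k = (\<Sum>(i, j)\<in>{..<n} \<times> {..<n}. \<bar>f i j - robinson_fit n f k i j\<bar>)"

text \<open>By this alternative the fit inherits both the range and binary values from
  \<open>f\<close>.\<close>

lemma robinson_fit_cases:
  "robinson_fit n f k i j = 0 \<or> (\<exists>p<n. \<exists>q<n. robinson_fit n f k i j = f p q)" if "i < n" "j < n"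
proof (cases "i = j")
  case True
  then show ?thesis using that by (auto simp: robinson_fit_def)
next
  case False
  have "p < n \<and> q < n" if "(p, q) \<in> rank_pts n f k (min i j) (max i j)" for p q
    using that \<open>i < n\<close> by (auto simp: rank_pts_def outer_def)
  with rank_val_cases[of n f k "min i j" "max i j"] False show ?thesis
    unfolding robinson_fit_def by auto
qed

lemma robinson_fit_range:
  assumes "i < n" "j < n" "\<And>i j. i < n \<Longrightarrow> j < n \<Longrightarrow> 0 \<le> f i j \<and> f i j \<le> 1"
  shows "0 \<le> robinson_fit n f k i j \<and> robinson_fit n f k i j \<le> 1"
  using robinson_fit_cases[OF assms(1,2), where f = f and k = k] assms(3) by auto

text \<open>By symmetry both triangles cost the same, the diagonal is reproduced exactly, and an
  absolute value splits into deficit and excess.\<close>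

lemma fit_cost_eq:
  assumes sym: "\<And>i j. i < n \<Longrightarrow> j < n \<Longrightarrow> f i j = f j i"
  shows "fit_cost n f k = 2 * (\<Sum>(i, j)\<in>upper_pairs n. pos_part (f i j - rank_val n f k i j))
     + 2 * (\<Sum>(i, j)\<in>upper_pairs n. pos_part (rank_val n f k i j - f i j))"
proof -
  let ?e = "\<lambda>x. \<bar>case_prod f x - case_prod (robinson_fit n f k) x\<bar>"
  let ?b = "prod.swap ` upper_pairs n"
  have diag: "?e x = 0" if "x \<in> {..<n} \<times> {..<n} - (upper_pairs n \<union> ?b)" for x
  proof -
    obtain i j where x: "x = (i, j)" by (cases x)
    with that have "\<not> i < j" "\<not> j < i"
      by (auto simp: upper_pairs_def image_iff)
    then show ?thesis by (simp add: x robinson_fit_def)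
  qed
  have "fit_cost n f k = (\<Sum>x\<in>{..<n} \<times> {..<n}. ?e x)"
    by (simp add: fit_cost_def case_prod_unfold)
  also have "\<dots> = (\<Sum>x\<in>upper_pairs n \<union> ?b. ?e x)"
  proof (rule sum.mono_neutral_right)
    show "\<forall>x\<in>{..<n} \<times> {..<n} - (upper_pairs n \<union> ?b). ?e x = 0"
      using diag by blast
  qed (auto simp: upper_pairs_def)
  also have "\<dots> = (\<Sum>x\<in>upper_pairs n. ?e x) + (\<Sum>x\<in>?b. ?e x)"
    by (rule sum.union_disjoint) (simp_all, auto simp: upper_pairs_def)
  also have "(\<Sum>x\<in>?b. ?e x) = (\<Sum>x\<in>upper_pairs n. ?e x)"
  proof -
    have "?e (prod.swap x) = ?e x" if "x \<in> upper_pairs n" for x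
      using that sym[of "fst x" "snd x"]
      by (cases x) (simp add: upper_pairs_def robinson_fit_def min.commute max.commute)
    then show ?thesis by (subst sum.reindex) simp_all
  qed
  also have "(\<Sum>x\<in>upper_pairs n. ?e x) = (\<Sum>x\<in>upper_pairs n. pos_part (case_prod f x - case_prod (rank_val n f k) x)
      + pos_part (case_prod (rank_val n f k) x - case_prod f x))"
    by (intro sum.cong) (auto simp: upper_pairs_def robinson_fit_def pos_part_def)
  finally show ?thesis by (simp add: sum.distrib case_prod_unfold)
qed

text \<open>Here \<open>x\<close> stands for the cube root of \<open>Gamma1\<close>. With
  \<open>y = x * n\<close>, the main case bounds the deficit above the diagonal by
  \<open>12 * n * y\<close> and the excess by \<open>n * y\<close>; both triangles together give
  \<open>2 * (12 + 1) = 26\<close>.\<close>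

lemma exists_cheap_fit:
  assumes n: "0 < n" and sym: "\<And>i j. i < n \<Longrightarrow> j < n \<Longrightarrow> f i j = f j i"
    and range: "\<And>i j. i < n \<Longrightarrow> j < n \<Longrightarrow> 0 \<le> f i j \<and> f i j \<le> 1"
    and x: "0 \<le> x" "violation n f = (x * real n) ^ 3"
  shows "\<exists>k\<le>n ^ 2. fit_cost n f k \<le> 26 * x * real n ^ 2"
proof -
  let ?D = "\<lambda>k. \<Sum>(i, j)\<in>upper_pairs n. pos_part (f i j - rank_val n f k i j)"
  let ?E = "\<lambda>k. \<Sum>(i, j)\<in>upper_pairs n. pos_part (rank_val n f k i j - f i j)"
  define y where "y = x * real n"
  have y: "0 \<le> y" "violation n f = y ^ 3" using x by (auto simp: y_def)
  have E: "real k * ?E k \<le> real n * y ^ 3" for k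
    using sum_excess_le[of n f k] range y by auto
  have "\<exists>k\<le>n ^ 2. fit_cost n f k \<le> 26 * y * real n"
  proof (cases "y \<le> 1")
    case True
    have "?D 1 = 0"
      using rank_val_one_ge[of _ _ n f] by (intro sum.neutral) (auto simp: pos_part_def max_def)
    moreover have "?E 1 \<le> real n * y"
    proof -
      have "y ^ 3 \<le> y ^ 1" using True y(1) by (intro power_decreasing) auto
      then show ?thesis using E[of 1] mult_left_mono[of "y ^ 3" y "real n"] by simp
    qed
    moreover have "fit_cost n f 1 = 2 * ?D 1 + 2 * ?E 1" by (rule fit_cost_eq[OF sym])
    ultimately have "fit_cost n f 1 \<le> 26 * y * real n"
      using mult_nonneg_nonneg[OF y(1), of "real n"] by (simp add: algebra_simps)
    moreover have "1 \<le> n ^ 2" using n by simp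
    ultimately show ?thesis by blast
  next
    case y1: False
    define m where "m = nat \<lceil>y\<rceil>"
    \<comment> \<open>Rounding up at most doubles \<open>y\<close>, because
      \<open>y > 1\<close>.\<close>
    have m: "y \<le> real m" "real m \<le> 2 * y" "0 < m"
      using y1 by (auto simp: m_def) linarith+
    show ?thesis
    proof (cases "m \<le> n")
      case True
      have "real ((n - 1) div m) \<le> real n / real m"
      proof -
        have "real ((n - 1) div m) \<le> real (n - 1) / real m" by (rule of_nat_div_le_of_nat)
        also have "\<dots> \<le> real n / real m" by (intro divide_right_mono) auto
        finally show ?thesis .
      qed
      moreover have "1 \<le> real n / real m" using True m by simp
      \<comment> \<open>As \<open>m \<le> n\<close>, the summand 1 is absorbed by a third copy of
        \<open>n / m\<close>. With \<open>k = m^2\<close> the deficit is then at most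
        \<open>6 * n * m\<close>.\<close>
      ultimately have q: "2 * real ((n - 1) div m) + 1 \<le> 3 * (real n / real m)" by linarith
      have "?D (m ^ 2) \<le> real ((2 * ((n - 1) div m) + 1) * (m ^ 2 + m ^ 2))"
        by (rule sum_deficit_le) (use m range in auto)
      also have "\<dots> = (2 * real ((n - 1) div m) + 1) * (2 * real m ^ 2)"
        by (simp add: algebra_simps)
      also have "\<dots> \<le> 3 * (real n / real m) * (2 * real m ^ 2)"
        using q by (intro mult_right_mono) auto
      also have "\<dots> = 6 * real n * real m"
        using m by (simp add: power2_eq_square)
      also have "\<dots> \<le> 12 * real n * y" using mult_left_mono[OF m(2), of "6 * real n"] by simp
      finally have D: "?D (m ^ 2) \<le> 12 * real n * y" .
      \<comment> \<open>Replacing the factor \<open>m^2\<close> by the smaller \<open>y^2\<close>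
        allows it to be cancelled against the bound \<open>n * y^3\<close>.\<close>
      have "y ^ 2 * ?E (m ^ 2) \<le> real (m ^ 2) * ?E (m ^ 2)"
        using m y by (intro mult_right_mono) (auto intro!: sum_nonneg power_mono simp: pos_part_def)
      also have "\<dots> \<le> y ^ 2 * (real n * y)"
        using E[of "m ^ 2"] by (simp add: power2_eq_square power3_eq_cube algebra_simps)
      finally have "?E (m ^ 2) \<le> real n * y"
        using y1 by (simp add: mult_le_cancel_left)
      with D fit_cost_eq[OF sym, where k = "m ^ 2"] have "fit_cost n f (m ^ 2) \<le> 26 * y * real n"
        by (simp add: algebra_simps)
      moreover have "m ^ 2 \<le> n ^ 2" using True by (simp add: power_mono)
      ultimately show ?thesis by blast
    next
      case False
      then have "real n \<le> 2 * y" using m by linarith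
      \<comment> \<open>For \<open>m > n\<close> the choice \<open>k = m^2\<close> would leave the
        range \<open>k \<le> n^2\<close>. But now \<open>n \<le> 2 * y\<close>, and the trivial
        bound 1 per entry suffices, here with \<open>k = 0\<close>.\<close>
      have "fit_cost n f 0 \<le> (\<Sum>(i, j)\<in>{..<n} \<times> {..<n}. 1)"
      proof -
        have "\<bar>f i j - robinson_fit n f 0 i j\<bar> \<le> 1" if "i < n" "j < n" for i j
          using robinson_fit_range[where f = f and k = 0 and n = n] range that by (smt (verit))
        then show ?thesis unfolding fit_cost_def by (intro sum_mono) auto
      qed
      also have "\<dots> = real n * real n" by simp
      also have "\<dots> \<le> real n * (2 * y)" using \<open>real n \<le> 2 * y\<close> by (intro mult_left_mono) auto
      also have "\<dots> \<le> 26 * y * real n" using y1 by simp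
      finally show ?thesis by blast
    qed
  qed
  then show ?thesis by (simp add: y_def power2_eq_square algebra_simps)
qed

section \<open>Hoare rules with time bounds\<close>

text \<open>An upper bound for the running time if every loop body is executed at most n times.\<close>

primrec steps :: "prog \<Rightarrow> nat poly" where
  "steps (Instr a) = 1"
| "steps (Seq c d) = steps c + steps d"
| "steps (Cond b c d) = 1 + steps c + steps d"
| "steps (Loop b c) = [:0, 1:] * (steps c + 1) + 1"

text \<open>Total correctness with a time bound read off the program text, so that one polynomial
  serves all inputs.\<close>

definition triple :: "nat \<Rightarrow> (state \<Rightarrow> bool) \<Rightarrow> prog \<Rightarrow> (state \<Rightarrow> bool) \<Rightarrow> bool" where
  "triple n P c Q \<longleftrightarrow> (\<forall>s. P s \<longrightarrow> (\<exists>t s'. exec c s t s' \<and> t \<le> poly (steps c) n \<and> Q s'))"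

lemma triple_Instr: "(\<And>s. P s \<Longrightarrow> Q (run_instr a s)) \<Longrightarrow> triple n P (Instr a) Q"
  unfolding triple_def by (fastforce intro: exec.Instr)

lemma triple_Seq: "triple n P c Q \<Longrightarrow> triple n Q d R \<Longrightarrow> triple n P (Seq c d) R"
  unfolding triple_def by (metis exec.Seq add_mono poly_add steps.simps(2))

lemma triple_Cond:
  assumes "triple n (\<lambda>s. P s \<and> holds b s) c Q" "triple n (\<lambda>s. P s \<and> \<not> holds b s) d Q"
  shows "triple n P (Cond b c d) Q"
  unfolding triple_def
proof (intro allI impI)
  fix s assume P: "P s"
  show "\<exists>t s'. exec (Cond b c d) s t s' \<and> t \<le> poly (steps (Cond b c d)) n \<and> Q s'"
  proof (cases "holds b s")
    case True
    with P assms(1) obtain t s' where "exec c s t s'" "t \<le> poly (steps c) n" "Q s'"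
      unfolding triple_def by blast
    with True show ?thesis by (intro exI[of _ "Suc t"] exI[of _ s']) (auto intro: exec.CondTrue)
  next
    case False
    with P assms(2) obtain t s' where "exec d s t s'" "t \<le> poly (steps d) n" "Q s'"
      unfolding triple_def by blast
    with False show ?thesis by (intro exI[of _ "Suc t"] exI[of _ s']) (auto intro: exec.CondFalse)
  qed
qed

lemma triple_weaken:
  assumes "triple n P c Q" "\<And>s. P' s \<Longrightarrow> P s" "\<And>s. Q s \<Longrightarrow> Q' s"
  shows "triple n P' c Q'"
  using assms unfolding triple_def by blast

text \<open>Fixing the initial state lets a postcondition refer to the values before the
  run.\<close>

lemma triple_pre: "(\<And>s. P s \<Longrightarrow> triple n (\<lambda>s'. s' = s) c Q) \<Longrightarrow> triple n P c Q"
  unfolding triple_def by blast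

text \<open>Adding register 1 increments, adding register 2 copies, and \<open>Cell a 2 2\<close>
  addresses the entry \<open>(0, 0)\<close> of an array.\<close>

definition std_regs :: "nat \<Rightarrow> state \<Rightarrow> bool" where
  "std_regs n s \<longleftrightarrow> idx s 0 = n \<and> idx s 1 = 1 \<and> idx s 2 = 0"

text \<open>Under \<open>std_regs\<close> register 2 already contains 0, so nothing changes.\<close>

definition skip :: prog where
  "skip = Instr (IdxConst 2 0)"

definition For :: "nat \<Rightarrow> prog \<Rightarrow> prog" where
  "For v c = Seq (Instr (IdxConst v 0)) (Loop (IdxLess v 0) (Seq c (Instr (IdxAdd v v 1))))"

lemma triple_skip:
  assumes "\<And>s. P s \<Longrightarrow> std_regs n s \<and> Q s"
  shows "triple n P skip Q"
  unfolding skip_def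
proof (rule triple_Instr)
  fix s assume "P s"
  then have "std_regs n s \<and> Q s" by (rule assms)
  moreover from this have "run_instr (IdxConst 2 0) s = s"
    by (simp add: std_regs_def fun_upd_idem)
  ultimately show "Q (run_instr (IdxConst 2 0) s)" by simp
qed

text \<open>\<open>indep\<close> carries the invariant over the initialization and the increments of
  \<open>v\<close>, and \<open>2 < v\<close> protects the constants in the registers 0, 1,
  2.\<close>

lemma triple_For:
  assumes v: "2 < v"
    and body: "\<And>a. a < n \<Longrightarrow>
      triple n (\<lambda>s. std_regs n s \<and> idx s v = a \<and> I a s) c (\<lambda>s. std_regs n s \<and> idx s v = a \<and> I (Suc a) s)"
    and indep: "\<And>a x s. I a s \<Longrightarrow> I a (s\<lparr>idx := (idx s)(v := x)\<rparr>)"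
  shows "triple n (\<lambda>s. std_regs n s \<and> I 0 s) (For v c) (\<lambda>s. std_regs n s \<and> I n s)"
proof -
  let ?L = "Loop (IdxLess v 0) (Seq c (Instr (IdxAdd v v 1)))"
  \<comment> \<open>Induction on the number \<open>d\<close> of remaining rounds. A round costs the
    test, the body and the increment, hence \<open>+ 2\<close>; the last \<open>+ 1\<close> is the
    failing test.\<close>
  have loop: "\<exists>t s'. exec ?L s t s' \<and> t \<le> d * (poly (steps c) n + 2) + 1 \<and> std_regs n s' \<and> I n s'"
    if "std_regs n s" "idx s v = a" "I a s" "a + d = n" for a d s
    using that
  proof (induction d arbitrary: a s)
    case 0
    then have "\<not> holds (IdxLess v 0) s" by (simp add: std_regs_def)
    from exec.LoopFalse[OF this] 0 show ?case
      by (intro exI[of _ 1] exI[of _ s]) auto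
  next
    case (Suc d)
    then have h: "holds (IdxLess v 0) s" by (simp add: std_regs_def)
    have "a < n" using Suc.prems by simp
    from body[OF this, unfolded triple_def, rule_format, of s] Suc.prems
    obtain t s1 where s1: "exec c s t s1" "t \<le> poly (steps c) n"
        "std_regs n s1" "idx s1 v = a" "I (Suc a) s1" by blast
    define s2 where "s2 = run_instr (IdxAdd v v 1) s1"
    have s2: "s2 = s1\<lparr>idx := (idx s1)(v := Suc a)\<rparr>"
      using s1 by (simp add: s2_def std_regs_def)
    have "std_regs n s2" "idx s2 v = Suc a" "I (Suc a) s2"
      using s1 v by (simp_all add: s2 std_regs_def indep)
    from Suc.IH[OF this] Suc.prems(4) obtain u s' where u: "exec ?L s2 u s'"
        "u \<le> d * (poly (steps c) n + 2) + 1" "std_regs n s'" "I n s'" by auto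
    have "exec (Seq c (Instr (IdxAdd v v 1))) s (t + 1) s2"
      unfolding s2_def by (rule exec.Seq[OF s1(1) exec.Instr])
    from exec.LoopTrue[OF h this u(1)] u s1(2) show ?case
      by (intro exI[of _ "Suc (t + 1 + u)"] exI[of _ s']) auto
  qed
  show ?thesis
    unfolding triple_def
  proof (intro allI impI)
    fix s assume s: "std_regs n s \<and> I 0 s"
    define s1 where "s1 = run_instr (IdxConst v 0) s"
    have "std_regs n s1" "idx s1 v = 0" "I 0 s1"
      using s v by (simp_all add: s1_def std_regs_def indep)
    from loop[OF this, of n] obtain t s' where t: "exec ?L s1 t s'"
      "t \<le> n * (poly (steps c) n + 2) + 1" "std_regs n s'" "I n s'" by auto
    have "exec (For v c) s (1 + t) s'"
      unfolding For_def by (rule exec.Seq[OF exec.Instr]) (use t in \<open>simp add: s1_def\<close>)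
    with t show "\<exists>t s'. exec (For v c) s t s' \<and> t \<le> poly (steps (For v c)) n \<and>
        std_regs n s' \<and> I n s'"
      by (intro exI[of _ "1 + t"] exI[of _ s']) (auto simp: For_def)
  qed
qed

definition For2 :: "nat \<Rightarrow> nat \<Rightarrow> prog \<Rightarrow> prog" where
  "For2 v w c = For v (For w c)"

text \<open>The invariant is indexed by the set \<open>D\<close> of visited pairs, so counts, sums
  and maxima over \<open>D\<close> can be used directly; \<open>(a, b) \<notin> D\<close> ensures
  that no pair is counted twice.\<close>

lemma triple_For2:
  assumes vw: "2 < v" "2 < w" "v \<noteq> w"
    and body: "\<And>D a b. D \<subseteq> {..<n} \<times> {..<n} \<Longrightarrow> (a, b) \<notin> D \<Longrightarrow> a < n \<Longrightarrow> b < n \<Longrightarrow>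
      triple n (\<lambda>s. std_regs n s \<and> idx s v = a \<and> idx s w = b \<and> I D s) c
        (\<lambda>s. std_regs n s \<and> idx s v = a \<and> idx s w = b \<and> I (insert (a, b) D) s)"
    and indep: "\<And>D x s. I D s \<Longrightarrow> I D (s\<lparr>idx := (idx s)(v := x)\<rparr>)"
      "\<And>D x s. I D s \<Longrightarrow> I D (s\<lparr>idx := (idx s)(w := x)\<rparr>)"
  shows "triple n (\<lambda>s. std_regs n s \<and> I {} s) (For2 v w c)
    (\<lambda>s. std_regs n s \<and> I ({..<n} \<times> {..<n}) s)"
proof -
  let ?D = "\<lambda>a b. {..<a} \<times> {..<n} \<union> {a} \<times> {..<b}"
  have inner: "triple n (\<lambda>s. std_regs n s \<and> (idx s v = a \<and> I (?D a 0) s)) (For w c) 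
     (\<lambda>s. std_regs n s \<and> (idx s v = a \<and> I (?D a n) s))" if a: "a < n" for a
  proof (rule triple_For[OF vw(2), where I = "\<lambda>b s. idx s v = a \<and> I (?D a b) s"])
    fix b assume b: "b < n"
    have "?D a (Suc b) = insert (a, b) (?D a b)" by auto
    moreover have "triple n (\<lambda>s. std_regs n s \<and> idx s v = a \<and> idx s w = b \<and> I (?D a b) s) c
        (\<lambda>s. std_regs n s \<and> idx s v = a \<and> idx s w = b \<and> I (insert (a, b) (?D a b)) s)"
      by (rule body) (use a b in auto)
    ultimately show "triple n (\<lambda>s. std_regs n s \<and> idx s w = b \<and> idx s v = a \<and> I (?D a b) s) c
         (\<lambda>s. std_regs n s \<and> idx s w = b \<and> idx s v = a \<and> I (?D a (Suc b)) s)"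
      by (simp only: conj_left_commute)
  qed (use vw in \<open>simp_all add: indep\<close>)
  have "triple n (\<lambda>s. std_regs n s \<and> I ({..<0} \<times> {..<n}) s) (For v (For w c)) (\<lambda>s. std_regs n s \<and> I ({..<n} \<times> {..<n}) s)"
  proof (rule triple_For[OF vw(1), where I = "\<lambda>a. I ({..<a} \<times> {..<n})"])
    fix a assume "a < n"
    have "?D a 0 = {..<a} \<times> {..<n}" "?D a n = {..<Suc a} \<times> {..<n}" by auto
    with inner[OF \<open>a < n\<close>] show "triple n (\<lambda>s. std_regs n s \<and> idx s v = a \<and> I ({..<a} \<times> {..<n}) s)
       (For w c) 
       (\<lambda>s. std_regs n s \<and> idx s v = a \<and> I ({..<Suc a} \<times> {..<n}) s)" by simp
  qed (simp_all add: indep)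
  then show ?thesis by (simp add: For2_def)
qed

section \<open>The program\<close>

text \<open>The zero cell of array 5 serves to copy a real number by an addition.\<close>

definition stored :: "nat \<Rightarrow> (nat \<Rightarrow> nat \<Rightarrow> real) \<Rightarrow> state \<Rightarrow> bool" where
  "stored n f s \<longleftrightarrow> (\<forall>i<n. \<forall>j<n. arr s (0, i, j) = f i j) \<and> arr s (5, 0, 0) = 0"

text \<open>
  Registers: 0, 1, 2 = the constants n, 1, 0, 3 = best k so far, 4 = k, 7, 8 = current entry,
  9, 10 = the same entry reflected into the upper triangle, 11, 12 = threshold entry,
  13, 14 = counted entry, 15 = counter.
  Arrays: 3 = current cost, 4 = best cost, 5 = zero, the latter three in the cell (0, 0).
\<close>

definition count_prog :: prog where
  "count_prog = Seq (Instr (IdxConst 15 0))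
    (For2 13 14
      (Cond (IdxLess 9 13) skip
      (Cond (IdxLess 14 10) skip
      (Cond (RealLess (Cell 0 13 14) (Cell 0 11 12)) skip
        (Instr (IdxAdd 15 15 1))))))"

text \<open>The output cell itself holds the running maximum; its initial value is the 0 in
  \<open>rank_val\<close>.\<close>

definition rank_prog :: prog where
  "rank_prog = Seq (Instr (RealConst (Cell 1 7 8) 0))
    (For2 11 12
      (Cond (IdxLess 9 11) skip
      (Cond (IdxLess 12 10) skip
      (Seq count_prog
      (Cond (IdxLess 15 4) skip
      (Cond (RealLess (Cell 1 7 8) (Cell 0 11 12))
        (Instr (RealAdd (Cell 1 7 8) (Cell 0 11 12) (Cell 5 2 2)))
        skip))))))"

definition entry_prog :: prog where
  "entry_prog = Seq
    (Cond (IdxLess 7 8)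
      (Seq (Instr (IdxAdd 9 7 2)) (Instr (IdxAdd 10 8 2)))
      (Seq (Instr (IdxAdd 9 8 2)) (Instr (IdxAdd 10 7 2))))
    (Cond (IdxLess 9 10) rank_prog (Instr (RealAdd (Cell 1 7 8) (Cell 0 7 8) (Cell 5 2 2))))"

text \<open>The comparison decides which of the two entries is subtracted, which yields the absolute
  value.\<close>

definition fit_prog :: prog where
  "fit_prog = Seq (Instr (RealConst (Cell 3 2 2) 0))
    (For2 7 8 (Seq entry_prog
      (Cond (RealLess (Cell 0 7 8) (Cell 1 7 8))
        (Seq (Instr (RealAdd (Cell 3 2 2) (Cell 3 2 2) (Cell 1 7 8)))
          (Instr (RealSub (Cell 3 2 2) (Cell 3 2 2) (Cell 0 7 8))))
        (Seq (Instr (RealAdd (Cell 3 2 2) (Cell 3 2 2) (Cell 0 7 8)))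
          (Instr (RealSub (Cell 3 2 2) (Cell 3 2 2) (Cell 1 7 8)))))))"

text \<open>Registers 5 and 6 act as a clock of \<open>n^2\<close> rounds, in which \<open>k\<close>
  takes the values \<open>1, ..., n^2\<close>.\<close>

definition search_prog :: prog where
  "search_prog = For2 5 6
    (Seq (Instr (IdxAdd 4 4 1))
    (Seq fit_prog
      (Cond (RealLess (Cell 3 2 2) (Cell 4 2 2))
        (Seq (Instr (RealAdd (Cell 4 2 2) (Cell 3 2 2) (Cell 5 2 2))) (Instr (IdxAdd 3 4 2)))
        skip)))"

text \<open>The first fit runs with \<open>k = 0\<close> and initializes the best cost. The last one
  rebuilds the best fit, since the search overwrites array 1.\<close>

definition main_prog :: prog where
  "main_prog = Seq (Instr (IdxConst 1 1))
    (Seq fit_prog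
    (Seq (Instr (RealAdd (Cell 4 2 2) (Cell 3 2 2) (Cell 5 2 2)))
    (Seq search_prog
    (Seq (Instr (IdxAdd 4 3 2)) fit_prog))))"

section \<open>Correctness, from the innermost loop outwards\<close>

text \<open>The programs for counting, ranking, entries and fits preserve the registers below 13,
  11, 9 and 7, so the loop registers of the enclosing programs survive.\<close>

lemma triple_count_prog:
  assumes s0: "std_regs n s0" "stored n f s0" "idx s0 9 = i" "idx s0 10 = j" "idx s0 11 = p" "idx s0 12 = q"
    and bounds: "i < n" "p < n" "q < n"
  shows "triple n (\<lambda>s. s = s0) count_prog (\<lambda>s. std_regs n s \<and> arr s = arr s0 \<and>
    (\<forall>r<13. idx s r = idx s0 r) \<and> idx s 15 = card {(p', q') \<in> outer n i j. f p q \<le> f p' q'})"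
proof -
  define C where "C = {(p', q') \<in> outer n i j. f p q \<le> f p' q'}"
  define I where "I = (\<lambda>(D :: (nat \<times> nat) set) (s :: state). arr s = arr s0 \<and> (\<forall>r<13. idx s r = idx s0 r) \<and> idx s 15 = card (D \<inter> C))"
  \<comment> \<open>As \<open>i < n\<close>, the quadrant lies in the square, so the double loop
    visits all of \<open>C\<close>.\<close>
  have C: "({..<n} \<times> {..<n}) \<inter> C = C" using bounds by (auto simp: C_def outer_def)
  have "triple n (\<lambda>s. s = s0) count_prog (\<lambda>s. std_regs n s \<and> I ({..<n} \<times> {..<n}) s)"
    unfolding count_prog_def
  proof (rule triple_Seq[where Q = "\<lambda>s. std_regs n s \<and> I {} s"])
    show "triple n (\<lambda>s. s = s0) (Instr (IdxConst 15 0)) (\<lambda>s. std_regs n s \<and> I {} s)"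
      by (rule triple_Instr) (use s0 in \<open>simp add: std_regs_def I_def\<close>)
  next
    let ?body = "Cond (IdxLess 9 13) skip (Cond (IdxLess 14 10) skip
      (Cond (RealLess (Cell 0 13 14) (Cell 0 11 12)) skip (Instr (IdxAdd 15 15 1))))"
    show "triple n (\<lambda>s. std_regs n s \<and> I {} s) (For2 13 14 ?body) (\<lambda>s. std_regs n s \<and> I ({..<n} \<times> {..<n}) s)"
    proof (rule triple_For2)
      fix D :: "(nat \<times> nat) set" and a b
      assume D: "D \<subseteq> {..<n} \<times> {..<n}" "(a, b) \<notin> D" and ab: "a < n" "b < n"
      have "finite D" using D(1) by (rule finite_subset) simp
      then have insert: "card (insert (a, b) (D \<inter> C)) = Suc (card (D \<inter> C))"
        using D(2) by simp
      have mem: "(a, b) \<in> C \<longleftrightarrow> a \<le> i \<and> j \<le> b \<and> f p q \<le> f a b"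
        using ab by (auto simp: C_def outer_def)
      have I: "idx s 9 = i" "idx s 10 = j" "idx s 11 = p" "idx s 12 = q"
          "arr s (0, a, b) = f a b" "arr s (0, p, q) = f p q" if "I D s" for s
        using that s0 ab bounds by (simp_all add: I_def stored_def)
      show "triple n (\<lambda>s. std_regs n s \<and> idx s 13 = a \<and> idx s 14 = b \<and> I D s) ?body
          (\<lambda>s. std_regs n s \<and> idx s 13 = a \<and> idx s 14 = b \<and> I (insert (a, b) D) s)"
      proof (intro triple_Cond triple_skip triple_Instr; elim conjE)
      qed (simp_all add: I mem, simp_all add: I_def insert mem std_regs_def)
    qed (auto simp: I_def)
  qed
  then show ?thesis unfolding I_def C by (simp add: C_def)
qed

lemma triple_rank_prog:
  assumes s0: "std_regs n s0" "stored n f s0" "idx s0 9 = i" "idx s0 10 = j"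
    and bounds: "i < n"
  shows "triple n (\<lambda>s. s = s0) rank_prog (\<lambda>s. std_regs n s \<and> (\<forall>r<11. idx s r = idx s0 r) \<and>
    arr s = (arr s0)((1, idx s0 7, idx s0 8) := rank_val n f (idx s0 4) i j))"
proof -
  let ?k = "idx s0 4" and ?c = "(1, idx s0 7, idx s0 8)"
  \<comment> \<open>The content of the output cell once the pairs in \<open>D\<close> have been
    visited.\<close>
  define m where "m D = Max (insert 0 (case_prod f ` (D \<inter> rank_pts n f ?k i j)))" for D
  define I where "I = (\<lambda>(D :: (nat \<times> nat) set) (s :: state). (\<forall>r<11. idx s r = idx s0 r) \<and> arr s = (arr s0)(?c := m D))"
  have m: "m ({..<n} \<times> {..<n}) = rank_val n f ?k i j"
  proof -
    have "({..<n} \<times> {..<n}) \<inter> rank_pts n f ?k i j = rank_pts n f ?k i j"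
      using bounds by (auto simp: rank_pts_def outer_def)
    then show ?thesis by (simp add: m_def rank_val_def)
  qed
  have "triple n (\<lambda>s. s = s0) rank_prog (\<lambda>s. std_regs n s \<and> I ({..<n} \<times> {..<n}) s)"
    unfolding rank_prog_def
  proof (rule triple_Seq[where Q = "\<lambda>s. std_regs n s \<and> I {} s"])
    show "triple n (\<lambda>s. s = s0) (Instr (RealConst (Cell 1 7 8) 0)) (\<lambda>s. std_regs n s \<and> I {} s)"
      by (rule triple_Instr) (use s0 in \<open>simp add: std_regs_def I_def m_def\<close>)
  next
    let ?upd = "Cond (IdxLess 15 4) skip (Cond (RealLess (Cell 1 7 8) (Cell 0 11 12))
      (Instr (RealAdd (Cell 1 7 8) (Cell 0 11 12) (Cell 5 2 2))) skip)"
    let ?body = "Cond (IdxLess 9 11) skip (Cond (IdxLess 12 10) skip (Seq count_prog ?upd))"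
    show "triple n (\<lambda>s. std_regs n s \<and> I {} s) (For2 11 12 ?body) (\<lambda>s. std_regs n s \<and> I ({..<n} \<times> {..<n}) s)"
    proof (rule triple_For2)
      fix D :: "(nat \<times> nat) set" and a b
      assume D: "D \<subseteq> {..<n} \<times> {..<n}" "(a, b) \<notin> D" and ab: "a < n" "b < n"
      define R where "R = rank_pts n f ?k i j"
      define P where "P = (\<lambda>D s. std_regs n s \<and> idx s 11 = a \<and> idx s 12 = b \<and> I D s)"
      let ?cnt = "card {(p', q') \<in> outer n i j. f a b \<le> f p' q'}"
      have fin: "finite (D \<inter> R)" by (simp add: R_def)
      have insert: "m (insert (a, b) D) = (if (a, b) \<in> R then max (f a b) (m D) else m D)"
        using fin by (auto simp: m_def R_def[symmetric] Int_insert_left insert_commute[of 0])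
      have mem: "(a, b) \<in> R \<longleftrightarrow> a \<le> i \<and> j \<le> b \<and> ?k \<le> ?cnt"
        using ab by (auto simp: R_def rank_pts_def outer_def)
      have I: "idx s 4 = ?k \<and> idx s 7 = idx s0 7 \<and> idx s 8 = idx s0 8 \<and> idx s 9 = i \<and> idx s 10 = j
          \<and> stored n f s \<and> arr s ?c = m D" if "I D s" for s
        using that s0 by (simp add: I_def stored_def)
      \<comment> \<open>Inside the quadrant, the counter decides membership in \<open>R\<close>, and
        the comparison implements the maximum in \<open>insert\<close>.\<close>
      have upd: "triple n (\<lambda>s. (P D s \<and> a \<le> i \<and> j \<le> b) \<and> idx s 15 = ?cnt) ?upd (P (insert (a, b) D))"
      proof (intro triple_Cond triple_skip)
        fix s assume s: "((P D s \<and> a \<le> i \<and> j \<le> b) \<and> idx s 15 = ?cnt) \<and> holds (IdxLess 15 4) s"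
        then have "I D s" by (simp add: P_def)
        from I[OF this] s have "(a, b) \<notin> R" by (simp add: mem)
        with s show "std_regs n s \<and> P (insert (a, b) D) s" by (simp add: P_def I_def insert)
      next
        fix s assume s: "(((P D s \<and> a \<le> i \<and> j \<le> b) \<and> idx s 15 = ?cnt) \<and> \<not> holds (IdxLess 15 4) s) \<and>
            \<not> holds (RealLess (Cell 1 7 8) (Cell 0 11 12)) s"
        then have "I D s" by (simp add: P_def)
        from I[OF this] s ab have "\<not> m D < f a b" by (auto simp: P_def stored_def)
        with s show "std_regs n s \<and> P (insert (a, b) D) s" by (simp add: P_def I_def insert)
      next
        show "triple n (\<lambda>s. (((P D s \<and> a \<le> i \<and> j \<le> b) \<and> idx s 15 = ?cnt) \<and> \<not> holds (IdxLess 15 4) s) \<and>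
            holds (RealLess (Cell 1 7 8) (Cell 0 11 12)) s)
          (Instr (RealAdd (Cell 1 7 8) (Cell 0 11 12) (Cell 5 2 2))) (P (insert (a, b) D))"
        proof (rule triple_Instr)
          fix s assume s: "(((P D s \<and> a \<le> i \<and> j \<le> b) \<and> idx s 15 = ?cnt) \<and> \<not> holds (IdxLess 15 4) s) \<and>
            holds (RealLess (Cell 1 7 8) (Cell 0 11 12)) s"
          then have "I D s" by (simp add: P_def)
          note * = I[OF this]
          from * s ab have "m D < f a b" "(a, b) \<in> R" by (auto simp: P_def stored_def mem)
          with * s ab show "P (insert (a, b) D) (run_instr (RealAdd (Cell 1 7 8) (Cell 0 11 12) (Cell 5 2 2)) s)"
            by (simp add: P_def I_def insert std_regs_def stored_def)
        qed
      qed
      have count: "triple n (\<lambda>s. P D s \<and> a \<le> i \<and> j \<le> b) count_prog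
          (\<lambda>s. (P D s \<and> a \<le> i \<and> j \<le> b) \<and> idx s 15 = ?cnt)"
      proof (rule triple_pre)
        fix s assume s: "P D s \<and> a \<le> i \<and> j \<le> b"
        then have "I D s" by (simp add: P_def)
        from I[OF this] s ab bounds
        have "triple n (\<lambda>s'. s' = s) count_prog (\<lambda>s'. std_regs n s' \<and> arr s' = arr s \<and>
            (\<forall>r<13. idx s' r = idx s r) \<and> idx s' 15 = ?cnt)"
          by (intro triple_count_prog) (auto simp: P_def)
        then show "triple n (\<lambda>s'. s' = s) count_prog
            (\<lambda>s'. (P D s' \<and> a \<le> i \<and> j \<le> b) \<and> idx s' 15 = ?cnt)"
          by (rule triple_weaken) (use s in \<open>simp_all add: P_def I_def\<close>)
      qed
      have "triple n (P D) ?body (P (insert (a, b) D))"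
      proof (intro triple_Cond triple_skip)
        fix s assume s: "P D s \<and> holds (IdxLess 9 11) s"
        then have "I D s" by (simp add: P_def)
        from I[OF this] s have "(a, b) \<notin> R" by (simp add: mem P_def)
        with s show "std_regs n s \<and> P (insert (a, b) D) s" by (simp add: P_def I_def insert)
      next
        fix s assume s: "(P D s \<and> \<not> holds (IdxLess 9 11) s) \<and> holds (IdxLess 12 10) s"
        then have "I D s" by (simp add: P_def)
        from I[OF this] s have "(a, b) \<notin> R" by (simp add: mem P_def)
        with s show "std_regs n s \<and> P (insert (a, b) D) s" by (simp add: P_def I_def insert)
      next
        have "a \<le> i \<and> j \<le> b" if "(P D s \<and> \<not> holds (IdxLess 9 11) s) \<and> \<not> holds (IdxLess 12 10) s" for s
          using that I[of s] by (auto simp: P_def)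
        then show "triple n (\<lambda>s. (P D s \<and> \<not> holds (IdxLess 9 11) s) \<and> \<not> holds (IdxLess 12 10) s)
            (Seq count_prog ?upd) (P (insert (a, b) D))"
          by (intro triple_weaken[OF triple_Seq[OF count upd]]) auto
      qed
      then show "triple n (\<lambda>s. std_regs n s \<and> idx s 11 = a \<and> idx s 12 = b \<and> I D s) ?body
          (\<lambda>s. std_regs n s \<and> idx s 11 = a \<and> idx s 12 = b \<and> I (insert (a, b) D) s)"
        by (simp add: P_def)
    qed (auto simp: I_def)
  qed
  then show ?thesis unfolding I_def m .
qed

lemma triple_entry_prog:
  assumes s0: "std_regs n s0" "stored n f s0" "idx s0 7 = i" "idx s0 8 = j"
    and bounds: "i < n" "j < n"
  shows "triple n (\<lambda>s. s = s0) entry_prog (\<lambda>s. std_regs n s \<and> (\<forall>r<9. idx s r = idx s0 r) \<and>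
    arr s = (arr s0)((1, i, j) := robinson_fit n f (idx s0 4) i j))"
proof -
  let ?k = "idx s0 4"
  define Q where "Q = (\<lambda>s :: state. std_regs n s \<and> arr s = arr s0 \<and> (\<forall>r<9. idx s r = idx s0 r)
    \<and> idx s 9 = min i j \<and> idx s 10 = max i j)"
  show ?thesis
    unfolding entry_prog_def
  proof (rule triple_Seq[where Q = Q])
    show "triple n (\<lambda>s. s = s0) (Cond (IdxLess 7 8)
      (Seq (Instr (IdxAdd 9 7 2)) (Instr (IdxAdd 10 8 2)))
      (Seq (Instr (IdxAdd 9 8 2)) (Instr (IdxAdd 10 7 2)))) Q"
    proof (rule triple_Cond)
      show "triple n (\<lambda>s. s = s0 \<and> holds (IdxLess 7 8) s)
          (Seq (Instr (IdxAdd 9 7 2)) (Instr (IdxAdd 10 8 2))) Q"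
        by (rule triple_Seq[where Q = "\<lambda>s. s = run_instr (IdxAdd 9 7 2) s0 \<and> i < j"]; rule triple_Instr)
          (use s0 in \<open>auto simp: Q_def std_regs_def\<close>)
      show "triple n (\<lambda>s. s = s0 \<and> \<not> holds (IdxLess 7 8) s)
          (Seq (Instr (IdxAdd 9 8 2)) (Instr (IdxAdd 10 7 2))) Q"
        by (rule triple_Seq[where Q = "\<lambda>s. s = run_instr (IdxAdd 9 8 2) s0 \<and> \<not> i < j"]; rule triple_Instr)
          (use s0 in \<open>auto simp: Q_def std_regs_def\<close>)
    qed
  next
    show "triple n Q (Cond (IdxLess 9 10) rank_prog
        (Instr (RealAdd (Cell 1 7 8) (Cell 0 7 8) (Cell 5 2 2))))
      (\<lambda>s. std_regs n s \<and> (\<forall>r<9. idx s r = idx s0 r) \<and> arr s = (arr s0)((1, i, j) := robinson_fit n f ?k i j))"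
    proof (intro triple_Cond triple_Instr)
      show "triple n (\<lambda>s. Q s \<and> holds (IdxLess 9 10) s) rank_prog
        (\<lambda>s. std_regs n s \<and> (\<forall>r<9. idx s r = idx s0 r) \<and> arr s = (arr s0)((1, i, j) := robinson_fit n f ?k i j))"
      proof (rule triple_pre)
        fix s assume s: "Q s \<and> holds (IdxLess 9 10) s"
        then have neq: "i \<noteq> j" by (auto simp: Q_def)
        have "triple n (\<lambda>s'. s' = s) rank_prog (\<lambda>s'. std_regs n s' \<and> (\<forall>r<11. idx s' r = idx s r) \<and>
            arr s' = (arr s)((1, idx s 7, idx s 8) := rank_val n f (idx s 4) (min i j) (max i j)))"
          by (rule triple_rank_prog) (use s s0 bounds in \<open>auto simp: Q_def stored_def\<close>)
        then show "triple n (\<lambda>s'. s' = s) rank_prog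
          (\<lambda>s. std_regs n s \<and> (\<forall>r<9. idx s r = idx s0 r) \<and> arr s = (arr s0)((1, i, j) := robinson_fit n f ?k i j))"
          by (rule triple_weaken) (use s s0 neq in \<open>simp_all add: Q_def robinson_fit_def\<close>)
      qed
    next
      fix s assume s: "Q s \<and> \<not> holds (IdxLess 9 10) s"
      then have eq: "i = j" by (auto simp: Q_def)
      show "std_regs n (run_instr (RealAdd (Cell 1 7 8) (Cell 0 7 8) (Cell 5 2 2)) s) \<and>
         (\<forall>r<9. idx (run_instr (RealAdd (Cell 1 7 8) (Cell 0 7 8) (Cell 5 2 2)) s) r = idx s0 r) \<and>
         arr (run_instr (RealAdd (Cell 1 7 8) (Cell 0 7 8) (Cell 5 2 2)) s) =
           (arr s0)((1, i, j) := robinson_fit n f ?k i j)"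
        using s s0 bounds eq by (simp add: Q_def robinson_fit_def std_regs_def stored_def)
    qed
  qed
qed

lemma triple_fit_prog:
  assumes s0: "std_regs n s0" "stored n f s0"
  shows "triple n (\<lambda>s. s = s0) fit_prog (\<lambda>s. std_regs n s \<and> stored n f s \<and> (\<forall>r<7. idx s r = idx s0 r) \<and>
    arr s (4, 0, 0) = arr s0 (4, 0, 0) \<and> arr s (3, 0, 0) = fit_cost n f (idx s0 4) \<and>
    (\<forall>i<n. \<forall>j<n. arr s (1, i, j) = robinson_fit n f (idx s0 4) i j))"
proof -
  let ?k = "idx s0 4"
  let ?e = "\<lambda>(i, j). \<bar>f i j - robinson_fit n f ?k i j\<bar>"
  define F where "F = (\<lambda>s :: state. stored n f s \<and> (\<forall>r<7. idx s r = idx s0 r) \<and> arr s (4, 0, 0) = arr s0 (4, 0, 0))"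
  define I where "I = (\<lambda>(D :: (nat \<times> nat) set) (s :: state). F s \<and> arr s (3, 0, 0) = sum ?e D \<and>
    (\<forall>(i, j)\<in>D. arr s (1, i, j) = robinson_fit n f ?k i j))"
  have "triple n (\<lambda>s. s = s0) fit_prog (\<lambda>s. std_regs n s \<and> I ({..<n} \<times> {..<n}) s)"
    unfolding fit_prog_def
  proof (rule triple_Seq[where Q = "\<lambda>s. std_regs n s \<and> I {} s"])
    show "triple n (\<lambda>s. s = s0) (Instr (RealConst (Cell 3 2 2) 0)) (\<lambda>s. std_regs n s \<and> I {} s)"
      by (rule triple_Instr) (use s0 in \<open>simp add: std_regs_def I_def F_def stored_def\<close>)
  next
    let ?acc = "Cond (RealLess (Cell 0 7 8) (Cell 1 7 8))
        (Seq (Instr (RealAdd (Cell 3 2 2) (Cell 3 2 2) (Cell 1 7 8)))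
          (Instr (RealSub (Cell 3 2 2) (Cell 3 2 2) (Cell 0 7 8))))
        (Seq (Instr (RealAdd (Cell 3 2 2) (Cell 3 2 2) (Cell 0 7 8)))
          (Instr (RealSub (Cell 3 2 2) (Cell 3 2 2) (Cell 1 7 8))))"
    show "triple n (\<lambda>s. std_regs n s \<and> I {} s) (For2 7 8 (Seq entry_prog ?acc))
      (\<lambda>s. std_regs n s \<and> I ({..<n} \<times> {..<n}) s)"
    proof (rule triple_For2)
      fix D :: "(nat \<times> nat) set" and a b
      assume D: "D \<subseteq> {..<n} \<times> {..<n}" "(a, b) \<notin> D" and ab: "a < n" "b < n"
      have "finite D" using D(1) by (rule finite_subset) simp
      then have insert: "sum ?e (insert (a, b) D) = \<bar>f a b - robinson_fit n f ?k a b\<bar> + sum ?e D"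
        using D(2) by simp
      \<comment> \<open>\<open>P\<close> omits the cost cell, because the new entry is in array 1
        before its error is added to the cost.\<close>
      define P where "P = (\<lambda>s. std_regs n s \<and> idx s 7 = a \<and> idx s 8 = b \<and> F s \<and>
        (\<forall>(i, j)\<in>insert (a, b) D. arr s (1, i, j) = robinson_fit n f ?k i j))"
      define c where "c = sum ?e D"
      have "triple n (\<lambda>s. std_regs n s \<and> idx s 7 = a \<and> idx s 8 = b \<and> I D s) entry_prog
          (\<lambda>s. P s \<and> arr s (3, 0, 0) = c)"
      proof (rule triple_pre)
        fix s assume s: "std_regs n s \<and> idx s 7 = a \<and> idx s 8 = b \<and> I D s"
        have "triple n (\<lambda>s'. s' = s) entry_prog (\<lambda>s'. std_regs n s' \<and> (\<forall>r<9. idx s' r = idx s r) \<and>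
            arr s' = (arr s)((1, a, b) := robinson_fit n f (idx s 4) a b))"
          by (rule triple_entry_prog) (use s ab in \<open>auto simp: I_def F_def\<close>)
        moreover have "idx s 4 = ?k" using s by (simp add: I_def F_def)
        ultimately show "triple n (\<lambda>s'. s' = s) entry_prog (\<lambda>s. P s \<and> arr s (3, 0, 0) = c)"
          by (elim triple_weaken) (use s in \<open>auto simp: P_def I_def F_def stored_def c_def\<close>)
      qed
      moreover have "triple n (\<lambda>s. P s \<and> arr s (3, 0, 0) = c) ?acc
          (\<lambda>s. P s \<and> arr s (3, 0, 0) = \<bar>f a b - robinson_fit n f ?k a b\<bar> + c)"
      proof (rule triple_Cond)
        show "triple n (\<lambda>s. (P s \<and> arr s (3, 0, 0) = c) \<and> holds (RealLess (Cell 0 7 8) (Cell 1 7 8)) s)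
            (Seq (Instr (RealAdd (Cell 3 2 2) (Cell 3 2 2) (Cell 1 7 8)))
              (Instr (RealSub (Cell 3 2 2) (Cell 3 2 2) (Cell 0 7 8))))
            (\<lambda>s. P s \<and> arr s (3, 0, 0) = \<bar>f a b - robinson_fit n f ?k a b\<bar> + c)"
          \<comment> \<open>The intermediate assertion remembers the outcome of the test, which
            fixes the sign inside the absolute value.\<close>
          by (rule triple_Seq[where Q = "\<lambda>s. P s \<and> arr s (3, 0, 0) = c + robinson_fit n f ?k a b \<and> f a b < robinson_fit n f ?k a b"];
              rule triple_Instr)
            (use ab in \<open>auto simp: P_def F_def std_regs_def stored_def\<close>)
        show "triple n (\<lambda>s. (P s \<and> arr s (3, 0, 0) = c) \<and> \<not> holds (RealLess (Cell 0 7 8) (Cell 1 7 8)) s)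
            (Seq (Instr (RealAdd (Cell 3 2 2) (Cell 3 2 2) (Cell 0 7 8)))
              (Instr (RealSub (Cell 3 2 2) (Cell 3 2 2) (Cell 1 7 8))))
            (\<lambda>s. P s \<and> arr s (3, 0, 0) = \<bar>f a b - robinson_fit n f ?k a b\<bar> + c)"
          by (rule triple_Seq[where Q = "\<lambda>s. P s \<and> arr s (3, 0, 0) = c + f a b \<and> \<not> f a b < robinson_fit n f ?k a b"];
              rule triple_Instr)
            (use ab in \<open>auto simp: P_def F_def std_regs_def stored_def\<close>)
      qed
      ultimately have "triple n (\<lambda>s. std_regs n s \<and> idx s 7 = a \<and> idx s 8 = b \<and> I D s) (Seq entry_prog ?acc)
          (\<lambda>s. P s \<and> arr s (3, 0, 0) = \<bar>f a b - robinson_fit n f ?k a b\<bar> + c)"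
        by (rule triple_Seq)
      then show "triple n (\<lambda>s. std_regs n s \<and> idx s 7 = a \<and> idx s 8 = b \<and> I D s) (Seq entry_prog ?acc)
          (\<lambda>s. std_regs n s \<and> idx s 7 = a \<and> idx s 8 = b \<and> I (insert (a, b) D) s)"
        by (rule triple_weaken) (simp_all add: P_def I_def insert c_def)
    qed (auto simp: I_def F_def stored_def)
  qed
  then show ?thesis
    by (rule triple_weaken) (simp_all add: I_def F_def fit_cost_def case_prod_unfold)
qed

lemma triple_search_prog:
  assumes s0: "std_regs n s0" "stored n f s0" "idx s0 3 = 0" "idx s0 4 = 0" "arr s0 (4, 0, 0) = fit_cost n f 0"
  shows "triple n (\<lambda>s. s = s0) search_prog (\<lambda>s. std_regs n s \<and> stored n f s \<and>
    (\<forall>k\<le>n ^ 2. fit_cost n f (idx s 3) \<le> fit_cost n f k))"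
proof -
  let ?c = "fit_cost n f"
  \<comment> \<open>\<open>J d\<close> covers \<open>k = 0, ..., d\<close>; at \<open>d = 0\<close>
    it holds because \<open>k = 0\<close> has been evaluated before the search.\<close>
  define J where "J = (\<lambda>d (s :: state). stored n f s \<and> arr s (4, 0, 0) = ?c (idx s 3) \<and> (\<forall>k\<le>d. ?c (idx s 3) \<le> ?c k))"
  define I where "I = (\<lambda>(D :: (nat \<times> nat) set) (s :: state). J (card D) s \<and> idx s 4 = card D)"
  have "triple n (\<lambda>s. std_regs n s \<and> I {} s) search_prog (\<lambda>s. std_regs n s \<and> I ({..<n} \<times> {..<n}) s)"
    unfolding search_prog_def
  proof (rule triple_For2)
    fix D :: "(nat \<times> nat) set" and a b
    assume D: "D \<subseteq> {..<n} \<times> {..<n}" "(a, b) \<notin> D" and ab: "a < n" "b < n"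
    have "finite D" using D(1) by (rule finite_subset) simp
    then have insert: "card (insert (a, b) D) = Suc (card D)" using D(2) by simp
    define P where "P = (\<lambda>d s. std_regs n s \<and> idx s 5 = a \<and> idx s 6 = b \<and> idx s 4 = Suc (card D) \<and> J d s)"
    let ?d = "card D" and ?c' = "?c (Suc (card D))"
    let ?upd = "Cond (RealLess (Cell 3 2 2) (Cell 4 2 2))
      (Seq (Instr (RealAdd (Cell 4 2 2) (Cell 3 2 2) (Cell 5 2 2))) (Instr (IdxAdd 3 4 2))) skip"
    have "triple n (\<lambda>s. std_regs n s \<and> idx s 5 = a \<and> idx s 6 = b \<and> I D s) (Instr (IdxAdd 4 4 1)) (P ?d)"
      by (rule triple_Instr) (auto simp: P_def I_def J_def std_regs_def stored_def)
    moreover have "triple n (P ?d) fit_prog (\<lambda>s. P ?d s \<and> arr s (3, 0, 0) = ?c')"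
    proof (rule triple_pre)
      fix s assume s: "P ?d s"
      then have "triple n (\<lambda>s'. s' = s) fit_prog (\<lambda>s'. std_regs n s' \<and> stored n f s' \<and>
          (\<forall>r<7. idx s' r = idx s r) \<and> arr s' (4, 0, 0) = arr s (4, 0, 0) \<and>
          arr s' (3, 0, 0) = fit_cost n f (idx s 4) \<and>
          (\<forall>i<n. \<forall>j<n. arr s' (1, i, j) = robinson_fit n f (idx s 4) i j))"
        by (intro triple_fit_prog) (auto simp: P_def J_def)
      then show "triple n (\<lambda>s'. s' = s) fit_prog (\<lambda>s. P ?d s \<and> arr s (3, 0, 0) = ?c')"
        by (rule triple_weaken) (use s in \<open>simp_all add: P_def J_def\<close>)
    qed
    moreover have "triple n (\<lambda>s. P ?d s \<and> arr s (3, 0, 0) = ?c') ?upd (P (Suc ?d))"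
    proof (intro triple_Cond triple_skip)
      show "triple n (\<lambda>s. (P ?d s \<and> arr s (3, 0, 0) = ?c') \<and> holds (RealLess (Cell 3 2 2) (Cell 4 2 2)) s)
          (Seq (Instr (RealAdd (Cell 4 2 2) (Cell 3 2 2) (Cell 5 2 2))) (Instr (IdxAdd 3 4 2))) (P (Suc ?d))"
      \<comment> \<open>Between the two assignments the best cost is new but register 3 is old, so
        the assertion speaks of \<open>?c'\<close> instead.\<close>
      proof (rule triple_Seq[where Q = "\<lambda>s. std_regs n s \<and> idx s 5 = a \<and> idx s 6 = b \<and> idx s 4 = Suc ?d \<and>
          stored n f s \<and> arr s (4, 0, 0) = ?c' \<and> (\<forall>k\<le>?d. ?c' \<le> ?c k)"]; rule triple_Instr)
      qed (auto simp: P_def J_def std_regs_def stored_def le_Suc_eq intro: less_imp_le less_le_trans)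
    next
      fix s assume "(P ?d s \<and> arr s (3, 0, 0) = ?c') \<and> \<not> holds (RealLess (Cell 3 2 2) (Cell 4 2 2)) s"
      then show "std_regs n s \<and> P (Suc ?d) s"
        by (auto simp: P_def J_def std_regs_def le_Suc_eq)
    qed
    ultimately have "triple n (\<lambda>s. std_regs n s \<and> idx s 5 = a \<and> idx s 6 = b \<and> I D s)
        (Seq (Instr (IdxAdd 4 4 1)) (Seq fit_prog ?upd)) (P (Suc ?d))"
      by (intro triple_Seq)
    then show "triple n (\<lambda>s. std_regs n s \<and> idx s 5 = a \<and> idx s 6 = b \<and> I D s)
        (Seq (Instr (IdxAdd 4 4 1)) (Seq fit_prog ?upd))
        (\<lambda>s. std_regs n s \<and> idx s 5 = a \<and> idx s 6 = b \<and> I (insert (a, b) D) s)"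
      by (rule triple_weaken) (simp_all add: P_def I_def insert)
  qed (auto simp: I_def J_def stored_def)
  then show ?thesis
    by (rule triple_weaken) (use s0 in \<open>simp_all add: I_def J_def power2_eq_square\<close>)
qed

lemma triple_main_prog:
  assumes s0: "idx s0 = (\<lambda>r. if r = 0 then n else 0)" "stored n f s0"
  shows "triple n (\<lambda>s. s = s0) main_prog
    (\<lambda>s. \<exists>k. (\<forall>i<n. \<forall>j<n. arr s (1, i, j) = robinson_fit n f k i j) \<and> (\<forall>l\<le>n ^ 2. fit_cost n f k \<le> fit_cost n f l))"
  unfolding main_prog_def
proof (rule triple_Seq)
  let ?ok = "\<lambda>s. std_regs n s \<and> stored n f s"
  let ?start = "\<lambda>s. ?ok s \<and> idx s 3 = 0 \<and> idx s 4 = 0"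
  let ?min = "\<lambda>k. \<forall>l\<le>n ^ 2. fit_cost n f k \<le> fit_cost n f l"
  show "triple n (\<lambda>s. s = s0) (Instr (IdxConst 1 1)) ?start"
    by (rule triple_Instr) (use s0 in \<open>simp add: std_regs_def stored_def\<close>)
  have refit: "triple n (\<lambda>s'. s' = s) fit_prog (\<lambda>s'. ?ok s' \<and> (\<forall>r<7. idx s' r = idx s r) \<and>
      arr s' (3, 0, 0) = fit_cost n f (idx s 4) \<and>
      (\<forall>i<n. \<forall>j<n. arr s' (1, i, j) = robinson_fit n f (idx s 4) i j))" if "?ok s" for s
    by (rule triple_weaken[OF triple_fit_prog[of n s f]]) (use that in auto)
  have 1: "triple n ?start fit_prog (\<lambda>s. ?start s \<and> arr s (3, 0, 0) = fit_cost n f 0)"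
    by (rule triple_pre, rule triple_weaken[OF refit]) auto
  have 2: "triple n (\<lambda>s. ?start s \<and> arr s (3, 0, 0) = fit_cost n f 0)
      (Instr (RealAdd (Cell 4 2 2) (Cell 3 2 2) (Cell 5 2 2))) (\<lambda>s. ?start s \<and> arr s (4, 0, 0) = fit_cost n f 0)"
    by (rule triple_Instr) (simp add: std_regs_def stored_def)
  have 3: "triple n (\<lambda>s. ?start s \<and> arr s (4, 0, 0) = fit_cost n f 0) search_prog (\<lambda>s. ?ok s \<and> ?min (idx s 3))"
    by (rule triple_pre, rule triple_weaken[OF triple_search_prog[of n _ f]]) auto
  have 4: "triple n (\<lambda>s. ?ok s \<and> ?min (idx s 3)) (Instr (IdxAdd 4 3 2)) (\<lambda>s. ?ok s \<and> ?min (idx s 4))"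
    by (rule triple_Instr) (simp add: std_regs_def stored_def)
  have 5: "triple n (\<lambda>s. ?ok s \<and> ?min (idx s 4)) fit_prog
      (\<lambda>s. \<exists>k. (\<forall>i<n. \<forall>j<n. arr s (1, i, j) = robinson_fit n f k i j) \<and> ?min k)"
    by (rule triple_pre, rule triple_weaken[OF refit]) auto
  show "triple n ?start (Seq fit_prog (Seq (Instr (RealAdd (Cell 4 2 2) (Cell 3 2 2) (Cell 5 2 2)))
      (Seq search_prog (Seq (Instr (IdxAdd 4 3 2)) fit_prog))))
      (\<lambda>s. \<exists>k. (\<forall>i<n. \<forall>j<n. arr s (1, i, j) = robinson_fit n f k i j) \<and> ?min k)"
    by (rule triple_Seq[OF 1 triple_Seq[OF 2 triple_Seq[OF 3 triple_Seq[OF 4 5]]]])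
qed

section \<open>Matrices\<close>

lemma elements_mat_subset_iff:
  "A \<in> carrier_mat n n \<Longrightarrow> elements_mat A \<subseteq> S \<longleftrightarrow> (\<forall>i<n. \<forall>j<n. A $$ (i, j) \<in> S)"
  by fastforce

lemma sym_unit_mats_iff:
  "A \<in> sym_unit_mats n \<longleftrightarrow> A \<in> carrier_mat n n \<and>
    (\<forall>i<n. \<forall>j<n. A $$ (i, j) = A $$ (j, i) \<and> 0 \<le> A $$ (i, j) \<and> A $$ (i, j) \<le> 1)"
proof (cases "A \<in> carrier_mat n n")
  case True
  then have "transpose_mat A = A \<longleftrightarrow> (\<forall>i<n. \<forall>j<n. A $$ (i, j) = A $$ (j, i))"
    by (auto simp: mat_eq_iff)
  with True show ?thesis
    by (auto simp: sym_unit_mats_def elements_mat_subset_iff)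
qed (simp add: sym_unit_mats_def)

lemma robinson_fit_sym:
  assumes "f i j = f j i"
  shows "robinson_fit n f k i j = robinson_fit n f k j i"
  using assms by (simp add: robinson_fit_def min.commute max.commute)

text \<open>Passing from \<open>(i, j)\<close> or \<open>(j, k)\<close> to \<open>(i, k)\<close>
  shrinks the quadrant, so \<open>rank_val_antimono\<close> applies.\<close>

lemma robinson_mat_fit:
  assumes "\<And>i j. i < n \<Longrightarrow> j < n \<Longrightarrow> f i j = f j i"
  shows "robinson (Matrix.mat n n (\<lambda>(i, j). robinson_fit n f k i j))"
proof -
  have "transpose_mat (Matrix.mat n n (\<lambda>(i, j). robinson_fit n f k i j)) = Matrix.mat n n (\<lambda>(i, j). robinson_fit n f k i j)"
    by (rule eq_matI) (auto intro!: robinson_fit_sym assms)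
  then show ?thesis
    by (auto simp: robinson_def robinson_fit_def intro: rank_val_antimono)
qed

lemma norm1_mat_diff_fit:
  assumes "A \<in> carrier_mat n n"
  shows "norm1_mat (A - Matrix.mat n n (\<lambda>(i, j). robinson_fit n (\<lambda>i j. A $$ (i, j)) k i j))
    = fit_cost n (\<lambda>i j. A $$ (i, j)) k / real n ^ 2"
  using assms by (simp add: norm1_mat_def fit_cost_def sum.cartesian_product)

text \<open>A \<open>k\<close> that beats all \<open>l \<le> n^2\<close> beats the one from
  \<open>exists_cheap_fit\<close>, so no cube root has to be computed.\<close>

lemma cheapest_fit_close:
  assumes n: "1 \<le> n" and A: "A \<in> sym_unit_mats n"
    and k: "\<forall>l\<le>n ^ 2. fit_cost n (\<lambda>i j. A $$ (i, j)) k \<le> fit_cost n (\<lambda>i j. A $$ (i, j)) l"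
  shows "norm1_mat (A - Matrix.mat n n (\<lambda>(i, j). robinson_fit n (\<lambda>i j. A $$ (i, j)) k i j)) \<le> 26 * root 3 (Gamma1 A)"
proof -
  let ?f = "\<lambda>i j. A $$ (i, j)"
  let ?x = "root 3 (Gamma1 A)"
  have carrier: "A \<in> carrier_mat n n" using A by (simp add: sym_unit_mats_iff)
  have Gamma: "Gamma1 A = violation n ?f / real n ^ 3"
    using carrier by (simp add: Gamma1_def violation_def)
  have "0 \<le> violation n ?f"
    unfolding violation_def by (intro sum_nonneg) (auto simp: pos_part_def)
  then have "0 \<le> Gamma1 A" by (simp add: Gamma)
  then have "0 \<le> ?x" "?x ^ 3 = Gamma1 A" by simp_all
  then have "violation n ?f = (?x * real n) ^ 3"
    using n by (simp add: Gamma power_mult_distrib)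
  moreover have "0 \<le> ?x" by fact
  ultimately obtain l where "l \<le> n ^ 2" "fit_cost n ?f l \<le> 26 * ?x * real n ^ 2"
    using exists_cheap_fit[of n ?f ?x] n A by (auto simp: sym_unit_mats_iff)
  with k have "fit_cost n ?f k \<le> 26 * ?x * real n ^ 2" by fastforce
  then show ?thesis
    using n by (simp add: norm1_mat_diff_fit[OF carrier] divide_le_eq)
qed

text \<open>Binarity enters as an implication, so that a single program serves general and binary
  inputs.\<close>

definition good_approx :: "nat \<Rightarrow> real mat \<Rightarrow> real mat \<Rightarrow> bool" where
  "good_approx n A R \<longleftrightarrow> R \<in> sym_unit_mats n \<and> robinson R \<and>
     norm1_mat (A - R) \<le> 26 * root 3 (Gamma1 A) \<and> (binary_mat A \<longrightarrow> binary_mat R)"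

lemma main_prog_correct:
  assumes n: "1 \<le> n" and A: "A \<in> sym_unit_mats n"
  shows "\<exists>t s. exec main_prog (input_state n A) t s \<and> t \<le> poly (steps main_prog) n \<and>
    good_approx n A (output_mat n s)"
proof -
  let ?f = "\<lambda>i j. A $$ (i, j)"
  have carrier: "A \<in> carrier_mat n n"
    and sym: "\<And>i j. i < n \<Longrightarrow> j < n \<Longrightarrow> ?f i j = ?f j i"
    and range: "\<And>i j. i < n \<Longrightarrow> j < n \<Longrightarrow> 0 \<le> ?f i j \<and> ?f i j \<le> 1"
    using A by (simp_all add: sym_unit_mats_iff)
  have "stored n ?f (input_state n A)" by (simp add: stored_def input_state_def)
  then have "triple n (\<lambda>s. s = input_state n A) main_prog
    (\<lambda>s. \<exists>k. (\<forall>i<n. \<forall>j<n. arr s (1, i, j) = robinson_fit n ?f k i j) \<and> (\<forall>l\<le>n ^ 2. fit_cost n ?f k \<le> fit_cost n ?f l))"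
    by (intro triple_main_prog) (simp_all add: input_state_def)
  then obtain t s k where exec: "exec main_prog (input_state n A) t s" "t \<le> poly (steps main_prog) n"
    and out: "\<forall>i<n. \<forall>j<n. arr s (1, i, j) = robinson_fit n ?f k i j"
    and k: "\<forall>l\<le>n ^ 2. fit_cost n ?f k \<le> fit_cost n ?f l"
    unfolding triple_def by blast
  define R where "R = Matrix.mat n n (\<lambda>(i, j). robinson_fit n ?f k i j)"
  have R: "output_mat n s = R"
    unfolding output_mat_def R_def using out by (intro eq_matI) auto
  have "R \<in> sym_unit_mats n"
    using robinson_fit_range[where f = ?f and k = k and n = n] range robinson_fit_sym[where f = ?f and k = k and n = n] sym
    by (simp add: sym_unit_mats_iff R_def)
  moreover have "robinson R"
    unfolding R_def by (rule robinson_mat_fit[OF sym])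
  moreover have "norm1_mat (A - R) \<le> 26 * root 3 (Gamma1 A)"
    unfolding R_def by (rule cheapest_fit_close[OF n A k])
  moreover have "binary_mat R" if "binary_mat A"
  proof -
    have "?f i j \<in> {0, 1}" if "i < n" "j < n" for i j
      using \<open>binary_mat A\<close> that carrier by (simp add: binary_mat_def elements_mat_subset_iff)
    then have "robinson_fit n ?f k i j \<in> {0, 1}" if "i < n" "j < n" for i j
      using robinson_fit_cases[OF that, where f = ?f and k = k] by (metis insert_iff)
    then show ?thesis
      unfolding binary_mat_def by (subst elements_mat_subset_iff[of _ n]) (auto simp: R_def)
  qed
  ultimately show ?thesis
    using exec unfolding good_approx_def R[symmetric] by blast
qed

theorem theorem2p2:
  shows "(\<forall>n\<ge>1. \<forall>A\<in>sym_unit_mats n. \<exists>R\<in>sym_unit_mats n.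
            robinson R \<and> norm1_mat (A - R) \<le> 26 * root 3 (Gamma1 A))
    \<and> poly_time_computable sym_unit_mats
         (\<lambda>n A R. R \<in> sym_unit_mats n \<and> robinson R \<and>
            norm1_mat (A - R) \<le> 26 * root 3 (Gamma1 A))
    \<and> (\<forall>n\<ge>1. \<forall>A\<in>sym_unit_mats n. binary_mat A \<longrightarrow>
         (\<exists>R\<in>sym_unit_mats n. binary_mat R \<and>
            robinson R \<and> norm1_mat (A - R) \<le> 26 * root 3 (Gamma1 A)))
    \<and> poly_time_computable (\<lambda>n. {A \<in> sym_unit_mats n. binary_mat A})
         (\<lambda>n A R. R \<in> sym_unit_mats n \<and> binary_mat R \<and> robinson R \<and>
            norm1_mat (A - R) \<le> 26 * root 3 (Gamma1 A))"
proof (intro conjI)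
  show "\<forall>n\<ge>1. \<forall>A\<in>sym_unit_mats n. \<exists>R\<in>sym_unit_mats n.
      robinson R \<and> norm1_mat (A - R) \<le> 26 * root 3 (Gamma1 A)"
    \<comment> \<open>Existence is read off from the output of the program.\<close>
    using main_prog_correct unfolding good_approx_def by blast
  show "\<forall>n\<ge>1. \<forall>A\<in>sym_unit_mats n. binary_mat A \<longrightarrow>
      (\<exists>R\<in>sym_unit_mats n. binary_mat R \<and>
        robinson R \<and> norm1_mat (A - R) \<le> 26 * root 3 (Gamma1 A))"
    using main_prog_correct unfolding good_approx_def by blast
  show "poly_time_computable sym_unit_mats
      (\<lambda>n A R. R \<in> sym_unit_mats n \<and> robinson R \<and> norm1_mat (A - R) \<le> 26 * root 3 (Gamma1 A))"
    unfolding poly_time_computable_def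
    by (intro exI[of _ main_prog] exI[of _ "steps main_prog"] allI impI ballI,
        drule (1) main_prog_correct) (auto simp: good_approx_def)
  show "poly_time_computable (\<lambda>n. {A \<in> sym_unit_mats n. binary_mat A})
      (\<lambda>n A R. R \<in> sym_unit_mats n \<and> binary_mat R \<and> robinson R \<and>
        norm1_mat (A - R) \<le> 26 * root 3 (Gamma1 A))"
    unfolding poly_time_computable_def
    by (intro exI[of _ main_prog] exI[of _ "steps main_prog"] allI impI ballI,
        elim CollectE conjE, drule (1) main_prog_correct) (auto simp: good_approx_def)
qed

end
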